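(* Let $K$ be a field, $S=K[x_1,\ldots,x_n]$ with $n\geq 2$, and let $I\subset S$ be a nonzero monomial ideal. Then the following statements are equivalent: (1) $I$ is an ideal of Borel type, i.e. $(I:x_j^\infty)=(I:(x_1,\ldots,x_j)^\infty)$ for all $j=1,\ldots,n$. (2) Each $p\in \mathrm{Ass}(S/I)$ has the form $p=(x_1,x_2,\ldots,x_r)$ for some $1\leq r\leq n$. (3) The ideal $I_{\geq q(I)}$ is stable.
   Context: For an ideal $J\subset S$, $(I:J^\infty)=\bigcup_{k\geq 1}(I:J^k)$, and $(I:x_j^\infty)=(I:(x_j)^\infty)$. For a monomial ideal $I$, $G(I)$ denotes its minimal set of monomial generators, and $\deg(I)$ is the highest degree of a monomial of $G(I)$. For a monomial $u$, $m(u)=\max\{i : x_i\mid u\}$ (with $m(1)=0$), and $m(I)=\max_{u\in G(I)} m(u)$. Set $q(I)=m(I)(\deg(I)-1)+1$. For an integer $e$, $I_{\geq e}$ is the ideal generated by the monomials of $I$ of degree $\geq e$. A monomial ideal $L$ is stable if for each monomial $u\in L$ and each $1\leq j<m(u)$ one has $x_ju/x_{m(u)}\in L$. $\mathrm{Ass}(S/I)$ is the set of associated prime ideals of $S/I$. *)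

theory Defs
  imports "HOL-Library.Poly_Mapping" "HOL-Algebra.Ideal_Product" "HOL-Algebra.QuotRing"
begin

text \<open>
  A monomial \<open>\<Prod>i. x\<^sub>i ^ (lookup u i)\<close> is represented by its exponent vector \<open>u\<close>, a finitely
  supported function on the variable indices; multiplying monomials is adding exponent vectors,
  so that \<open>(nat \<Rightarrow>\<^sub>0 nat) \<Rightarrow>\<^sub>0 'k\<close> with its convolution product is the polynomial ring over
  \<open>'k\<close> in countably many variables. \<open>K[x\<^sub>1,\<dots>,x\<^sub>n]\<close> is the subring of polynomials in the
  variables with indices \<open>1,\<dots>,n\<close>.
\<close>

type_synonym monom = "nat \<Rightarrow>\<^sub>0 nat"

definition monoms :: "nat \<Rightarrow> monom set"
  where "monoms n = {u. Poly_Mapping.keys u \<subseteq> {1..n}}"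

definition mpoly_ring :: "nat \<Rightarrow> (monom \<Rightarrow>\<^sub>0 'k::field) ring"
  where "mpoly_ring n =
    \<lparr>carrier = {p. Poly_Mapping.keys p \<subseteq> monoms n}, mult = (*), one = 1, zero = 0, add = (+)\<rparr>"

definition mon :: "monom \<Rightarrow> (monom \<Rightarrow>\<^sub>0 'k::field)"
  where "mon u = Poly_Mapping.single u 1"

abbreviation var_exp :: "nat \<Rightarrow> monom"
  where "var_exp i \<equiv> Poly_Mapping.single i 1"

definition var :: "nat \<Rightarrow> (monom \<Rightarrow>\<^sub>0 'k::field)"
  where "var i = mon (var_exp i)"

definition mdegree :: "monom \<Rightarrow> nat"
  where "mdegree u = (\<Sum>i\<in>Poly_Mapping.keys u. Poly_Mapping.lookup u i)"

definition max_var :: "monom \<Rightarrow> nat"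
  where "max_var u = (if u = 0 then 0 else Max (Poly_Mapping.keys u))"


definition ideal_colon :: "('a, 'b) ring_scheme \<Rightarrow> 'a set \<Rightarrow> 'a set \<Rightarrow> 'a set"
  where "ideal_colon R I J = {f \<in> carrier R. \<forall>g\<in>J. f \<otimes>\<^bsub>R\<^esub> g \<in> I}"

text \<open>Powers of ideals are powers in \<^const>\<open>ideals_set\<close>, whose multiplication is the product of ideals.\<close>

definition ideal_saturation :: "('a, 'b) ring_scheme \<Rightarrow> 'a set \<Rightarrow> 'a set \<Rightarrow> 'a set"
  where "ideal_saturation R I J = (\<Union>k\<in>{1::nat..}. ideal_colon R I (J [^]\<^bsub>ideals_set R\<^esub> k))"

text \<open>
  \<open>Ass(R/I)\<close>: the prime ideals that are annihilators of an element of the \<open>R\<close>-module \<open>R/I\<close>, on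
  which \<open>a \<in> R\<close> acts as multiplication by its residue class.
\<close>

definition associated_primes :: "('a, 'b) ring_scheme \<Rightarrow> 'a set \<Rightarrow> 'a set set"
  where "associated_primes R I =
    {P. primeideal P R \<and>
        (\<exists>c\<in>carrier (R Quot I).
           P = {a \<in> carrier R. (I +>\<^bsub>R\<^esub> a) \<otimes>\<^bsub>R Quot I\<^esub> c = \<zero>\<^bsub>R Quot I\<^esub>})}"


definition monomial_ideal :: "nat \<Rightarrow> (monom \<Rightarrow>\<^sub>0 'k::field) set \<Rightarrow> bool"
  where "monomial_ideal n I \<longleftrightarrow> (\<exists>A\<subseteq>monoms n. I = Idl\<^bsub>mpoly_ring n\<^esub> (mon ` A))"

text \<open>
  \<open>B = G(I)\<close>: a set of monomials generating \<open>I\<close>, no proper subset of which generates \<open>I\<close>.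
  Existence and uniqueness are proved in \<open>min_mon_gens_unique\<close> below.
\<close>

definition is_min_mon_gens :: "nat \<Rightarrow> (monom \<Rightarrow>\<^sub>0 'k::field) set \<Rightarrow> monom set \<Rightarrow> bool"
  where "is_min_mon_gens n I B \<longleftrightarrow>
    B \<subseteq> monoms n \<and> Idl\<^bsub>mpoly_ring n\<^esub> (mon ` B) = I \<and>
    (\<forall>C. C \<subset> B \<longrightarrow> Idl\<^bsub>mpoly_ring n\<^esub> (mon ` C) \<noteq> I)"

definition min_mon_gens :: "nat \<Rightarrow> (monom \<Rightarrow>\<^sub>0 'k::field) set \<Rightarrow> monom set"
  where "min_mon_gens n I = (THE B. is_min_mon_gens n I B)"

definition ideal_deg :: "nat \<Rightarrow> (monom \<Rightarrow>\<^sub>0 'k::field) set \<Rightarrow> nat"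
  where "ideal_deg n I = Max (mdegree ` min_mon_gens n I)"

definition ideal_max_var :: "nat \<Rightarrow> (monom \<Rightarrow>\<^sub>0 'k::field) set \<Rightarrow> nat"
  where "ideal_max_var n I = Max (max_var ` min_mon_gens n I)"

definition q_bound :: "nat \<Rightarrow> (monom \<Rightarrow>\<^sub>0 'k::field) set \<Rightarrow> int"
  where "q_bound n I = int (ideal_max_var n I) * (int (ideal_deg n I) - 1) + 1"

definition ideal_geq :: "nat \<Rightarrow> (monom \<Rightarrow>\<^sub>0 'k::field) set \<Rightarrow> int \<Rightarrow> (monom \<Rightarrow>\<^sub>0 'k) set"
  where "ideal_geq n I e =
    Idl\<^bsub>mpoly_ring n\<^esub> (mon ` {u \<in> monoms n. mon u \<in> I \<and> e \<le> int (mdegree u)})"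

text \<open>
  The exponent vector of \<open>x\<^sub>j u / x\<^sub>m\<close>, \<open>m = m(u)\<close>, is written with the pointwise truncated
  difference; nothing is truncated, since \<open>1 \<le> j < m(u)\<close> forces \<open>u \<noteq> 1\<close>, and then \<open>x\<^sub>m\<close> divides \<open>u\<close>.
\<close>

definition stable_ideal :: "nat \<Rightarrow> (monom \<Rightarrow>\<^sub>0 'k::field) set \<Rightarrow> bool"
  where "stable_ideal n L \<longleftrightarrow>
    monomial_ideal n L \<and>
    (\<forall>u\<in>monoms n. mon u \<in> L \<longrightarrow>
       (\<forall>j. 1 \<le> j \<and> j < max_var u \<longrightarrow> mon (var_exp j + u - var_exp (max_var u)) \<in> L))"

definition borel_type :: "nat \<Rightarrow> (monom \<Rightarrow>\<^sub>0 'k::field) set \<Rightarrow> bool"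
  where "borel_type n I \<longleftrightarrow>
    (\<forall>j\<in>{1..n}.
       ideal_saturation (mpoly_ring n) I (Idl\<^bsub>mpoly_ring n\<^esub> {var j}) =
       ideal_saturation (mpoly_ring n) I (Idl\<^bsub>mpoly_ring n\<^esub> (var ` {1..j})))"


lemma monoms_add: "u \<in> monoms n \<Longrightarrow> v \<in> monoms n \<Longrightarrow> u + v \<in> monoms n"
  using Poly_Mapping.keys_add[of u v] by (auto simp: monoms_def)

lemma mpoly_ring_cring: "cring (mpoly_ring n :: (monom \<Rightarrow>\<^sub>0 'k::field) ring)"
proof (rule cringI)
  show "abelian_group (mpoly_ring n :: (monom \<Rightarrow>\<^sub>0 'k) ring)"
  proof (rule abelian_groupI)
    fix p :: "monom \<Rightarrow>\<^sub>0 'k" assume "p \<in> carrier (mpoly_ring n)"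
    then have "-p \<in> carrier (mpoly_ring n)" "-p + p = 0"
      by (auto simp: mpoly_ring_def)
    then show "\<exists>q\<in>carrier (mpoly_ring n). q \<oplus>\<^bsub>mpoly_ring n\<^esub> p = \<zero>\<^bsub>mpoly_ring n\<^esub>"
      by (intro bexI[of _ "-p"]) (simp_all add: mpoly_ring_def)
  next
    fix p q :: "monom \<Rightarrow>\<^sub>0 'k"
    assume "p \<in> carrier (mpoly_ring n)" "q \<in> carrier (mpoly_ring n)"
    then show "p \<oplus>\<^bsub>mpoly_ring n\<^esub> q \<in> carrier (mpoly_ring n)"
      using Poly_Mapping.keys_add[of p q] by (auto simp: mpoly_ring_def)
  qed (auto simp: mpoly_ring_def algebra_simps)
next
  show "comm_monoid (mpoly_ring n :: (monom \<Rightarrow>\<^sub>0 'k) ring)"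
  proof (rule comm_monoidI)
    fix p q :: "monom \<Rightarrow>\<^sub>0 'k"
    assume "p \<in> carrier (mpoly_ring n)" "q \<in> carrier (mpoly_ring n)"
    then show "p \<otimes>\<^bsub>mpoly_ring n\<^esub> q \<in> carrier (mpoly_ring n)"
      using Poly_Mapping.keys_mult[of p q] by (force simp: mpoly_ring_def intro: monoms_add)
  qed (auto simp: mpoly_ring_def monoms_def algebra_simps)
qed (auto simp: mpoly_ring_def algebra_simps)

lemma mon_in_carrier: "u \<in> monoms n \<Longrightarrow> mon u \<in> carrier (mpoly_ring n)"
  by (simp add: mon_def mpoly_ring_def)

lemma mon_in_genideal_iff:
  assumes B: "B \<subseteq> monoms n" and u: "u \<in> monoms n"
  shows "(mon u :: monom \<Rightarrow>\<^sub>0 'k::field) \<in> Idl\<^bsub>mpoly_ring n\<^esub> (mon ` B) \<longleftrightarrow> (\<exists>b\<in>B. \<exists>c. u = b + c)"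
proof
  interpret R: cring "mpoly_ring n :: (monom \<Rightarrow>\<^sub>0 'k) ring" by (rule mpoly_ring_cring)
  let ?R = "mpoly_ring n :: (monom \<Rightarrow>\<^sub>0 'k) ring"
  define T where "T = {p \<in> carrier ?R. \<forall>v\<in>Poly_Mapping.keys p. \<exists>b\<in>B. \<exists>c. v = b + c}"
  assume "(mon u :: monom \<Rightarrow>\<^sub>0 'k) \<in> Idl\<^bsub>?R\<^esub> (mon ` B)"
  moreover have "ideal T ?R"
  proof (rule idealI)
    show "subgroup T (add_monoid ?R)"
    proof (rule R.add.subgroupI)
      fix p assume p: "p \<in> T"
      then have "\<ominus>\<^bsub>?R\<^esub> p = - p"
        by (intro R.minus_equality) (auto simp: T_def mpoly_ring_def)
      then show "\<ominus>\<^bsub>?R\<^esub> p \<in> T"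
        using p by (auto simp: T_def mpoly_ring_def)
    next
      fix p q assume pq: "p \<in> T" "q \<in> T"
      then have "p \<oplus>\<^bsub>?R\<^esub> q \<in> carrier ?R" by (auto simp: T_def)
      moreover have "\<exists>b\<in>B. \<exists>c. v = b + c" if "v \<in> Poly_Mapping.keys (p + q)" for v
        using that pq Poly_Mapping.keys_add[of p q] by (auto simp: T_def)
      ultimately show "p \<oplus>\<^bsub>?R\<^esub> q \<in> T"
        by (auto simp: T_def mpoly_ring_def)
    next
      have "0 \<in> T" by (simp add: T_def mpoly_ring_def)
      then show "T \<noteq> {}" by blast
    qed (auto simp: T_def)
  next
    fix p x assume p: "p \<in> T" and x: "x \<in> carrier ?R"
    have "\<exists>b\<in>B. \<exists>c. v = b + c" if v: "v \<in> Poly_Mapping.keys (x * p)" for v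
    proof -
      obtain a b where ab: "v = a + b" "b \<in> Poly_Mapping.keys p"
        using v Poly_Mapping.keys_mult[of x p] by blast
      then obtain b' c where "b' \<in> B" "b = b' + c" using p by (auto simp: T_def)
      then show ?thesis using ab by (intro bexI[of _ b'] exI[of _ "a + c"]) (auto simp: ac_simps)
    qed
    moreover have "x \<otimes>\<^bsub>?R\<^esub> p \<in> carrier ?R" using p x by (auto simp: T_def)
    ultimately show "x \<otimes>\<^bsub>?R\<^esub> p \<in> T" by (auto simp: T_def mpoly_ring_def)
    then show "p \<otimes>\<^bsub>?R\<^esub> x \<in> T" using p x R.m_comm by (auto simp: T_def)
  qed (rule R.ring_axioms)
  moreover have "mon ` B \<subseteq> T"
  proof
    fix p :: "monom \<Rightarrow>\<^sub>0 'k" assume "p \<in> mon ` B"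
    then obtain b where b: "b \<in> B" "p = mon b" by blast
    then have "p \<in> carrier ?R" using B by (auto intro: mon_in_carrier)
    moreover have "Poly_Mapping.keys p = {b}" using b by (simp add: mon_def)
    ultimately show "p \<in> T" using b by (auto simp: T_def intro!: bexI[of _ b] exI[of _ 0])
  qed
  ultimately have "(mon u :: monom \<Rightarrow>\<^sub>0 'k) \<in> T"
    by (auto simp: genideal_def)
  then show "\<exists>b\<in>B. \<exists>c. u = b + c" by (simp add: T_def mon_def)
next
  interpret R: cring "mpoly_ring n :: (monom \<Rightarrow>\<^sub>0 'k) ring" by (rule mpoly_ring_cring)
  let ?R = "mpoly_ring n :: (monom \<Rightarrow>\<^sub>0 'k) ring"
  have sub: "(mon ` B :: (monom \<Rightarrow>\<^sub>0 'k) set) \<subseteq> carrier ?R" using B by (auto intro: mon_in_carrier)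
  interpret I: ideal "Idl\<^bsub>?R\<^esub> (mon ` B)" ?R by (rule R.genideal_ideal[OF sub])
  assume "\<exists>b\<in>B. \<exists>c. u = b + c"
  then obtain b c where bc: "b \<in> B" "u = b + c" by blast
  have "Poly_Mapping.keys c \<subseteq> Poly_Mapping.keys u"
    using bc by (auto simp: in_keys_iff lookup_add)
  then have "c \<in> monoms n" using u by (auto simp: monoms_def)
  moreover have "(mon b :: monom \<Rightarrow>\<^sub>0 'k) \<in> Idl\<^bsub>?R\<^esub> (mon ` B)"
    using R.genideal_self[OF sub] bc by blast
  ultimately have "(mon c :: monom \<Rightarrow>\<^sub>0 'k) \<otimes>\<^bsub>?R\<^esub> mon b \<in> Idl\<^bsub>?R\<^esub> (mon ` B)"
    by (intro I.I_l_closed mon_in_carrier)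
  moreover have "(mon c :: monom \<Rightarrow>\<^sub>0 'k) \<otimes>\<^bsub>?R\<^esub> mon b = mon u"
    using bc by (simp add: mpoly_ring_def mon_def Poly_Mapping.mult_single add.commute)
  ultimately show "(mon u :: monom \<Rightarrow>\<^sub>0 'k) \<in> Idl\<^bsub>?R\<^esub> (mon ` B)" by simp
qed

lemma mdegree_add: "mdegree (u + v) = mdegree u + mdegree v"
proof -
  have *: "mdegree w = (\<Sum>i\<in>Poly_Mapping.keys u \<union> Poly_Mapping.keys v. Poly_Mapping.lookup w i)"
    if "Poly_Mapping.keys w \<subseteq> Poly_Mapping.keys u \<union> Poly_Mapping.keys v" for w
    unfolding mdegree_def using that by (intro sum.mono_neutral_left) (auto simp: in_keys_iff)
  show ?thesis
    using Poly_Mapping.keys_add[of u v] by (simp add: * lookup_add sum.distrib)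
qed

lemma mdegree_eq_0_iff: "mdegree u = 0 \<longleftrightarrow> u = 0"
proof
  assume "mdegree u = 0"
  then show "u = 0" by (auto simp: mdegree_def in_keys_iff intro: poly_mapping_eqI)
qed (simp add: mdegree_def)

lemma min_mon_gens_unique:
  fixes I :: "(monom \<Rightarrow>\<^sub>0 'k::field) set"
  assumes "monomial_ideal n I"
  shows "is_min_mon_gens n I B \<longleftrightarrow>
    B = {u \<in> monoms n. mon u \<in> I \<and> (\<forall>b c. u = b + c \<longrightarrow> mon b \<in> I \<longrightarrow> c = 0)}"
proof -
  interpret R: cring "mpoly_ring n :: (monom \<Rightarrow>\<^sub>0 'k) ring" by (rule mpoly_ring_cring)
  let ?R = "mpoly_ring n :: (monom \<Rightarrow>\<^sub>0 'k) ring"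
  define M where "M = {u \<in> monoms n. mon u \<in> I \<and> (\<forall>b c. u = b + c \<longrightarrow> mon b \<in> I \<longrightarrow> c = 0)}"
  obtain A where A: "A \<subseteq> monoms n" "I = Idl\<^bsub>?R\<^esub> (mon ` A)"
    using assms by (auto simp: monomial_ideal_def)
  have carr: "(mon ` C :: (monom \<Rightarrow>\<^sub>0 'k) set) \<subseteq> carrier ?R" if "C \<subseteq> monoms n" for C
    using that by (auto intro: mon_in_carrier)
  have M: "M \<subseteq> monoms n" "mon ` M \<subseteq> I" by (auto simp: M_def)
  have least: "M \<subseteq> C" if C: "C \<subseteq> monoms n" "Idl\<^bsub>?R\<^esub> (mon ` C) = I" for C
  proof
    fix u assume u: "u \<in> M"
    then obtain b c where bc: "b \<in> C" "u = b + c"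
      using mon_in_genideal_iff[of C n u, where 'k = 'k] C by (auto simp: M_def)
    have "mon b \<in> I" using R.genideal_self[OF carr[OF C(1)]] C(2) bc by blast
    then have "c = 0" using u bc by (auto simp: M_def)
    then show "u \<in> C" using bc by simp
  qed
  have below: "\<exists>b\<in>M. \<exists>c. u = b + c" if "u \<in> monoms n" "mon u \<in> I" for u
    using that
  proof (induction "mdegree u" arbitrary: u rule: less_induct)
    case less
    show ?case
    proof (cases "u \<in> M")
      case True
      then show ?thesis by (intro bexI[of _ u] exI[of _ 0]) auto
    next
      case False
      then obtain b c where bc: "u = b + c" "mon b \<in> I" "c \<noteq> 0"
        using less.prems by (auto simp: M_def)
      have "Poly_Mapping.keys b \<subseteq> Poly_Mapping.keys u"
        using bc by (auto simp: in_keys_iff lookup_add)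
      then have "b \<in> monoms n" using less.prems by (auto simp: monoms_def)
      moreover have "mdegree b < mdegree u"
        using bc mdegree_eq_0_iff[of c] by (simp add: mdegree_add)
      ultimately obtain b' c' where "b' \<in> M" "b = b' + c'" using less.hyps bc by blast
      then show ?thesis using bc by (intro bexI[of _ b'] exI[of _ "c' + c"]) (auto simp: ac_simps)
    qed
  qed
  have gen: "Idl\<^bsub>?R\<^esub> (mon ` M) = I"
  proof
    have "ideal I ?R" using A R.genideal_ideal[OF carr[OF A(1)]] by simp
    then show "Idl\<^bsub>?R\<^esub> (mon ` M) \<subseteq> I" using M(2) by (rule R.genideal_minimal)
    have "mon ` A \<subseteq> I" using A R.genideal_self[OF carr[OF A(1)]] by simp
    then have "mon ` A \<subseteq> Idl\<^bsub>?R\<^esub> (mon ` M)"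
      using below mon_in_genideal_iff[OF M(1), where 'k = 'k] A(1) by blast
    then show "I \<subseteq> Idl\<^bsub>?R\<^esub> (mon ` M)"
      unfolding A(2) by (intro R.genideal_minimal R.genideal_ideal carr M)
  qed
  have "is_min_mon_gens n I B \<longleftrightarrow> B = M"
  proof
    assume B: "is_min_mon_gens n I B"
    then have "M \<subseteq> B" using least by (auto simp: is_min_mon_gens_def)
    then show "B = M" using B gen by (auto simp: is_min_mon_gens_def)
  next
    assume "B = M"
    then show "is_min_mon_gens n I B"
      using M(1) gen least unfolding is_min_mon_gens_def
      by (metis order.trans psubset_imp_subset psubset_eq subset_antisym)
  qed
  then show ?thesis by (simp add: M_def)
qed

end

theory Submission
  imports Defs "HOL.Topological_Spaces"
begin

text \<open>
  Let \<open>M\<close> be the set of exponent vectors of the monomials of \<open>I\<close>. All three conditions are equivalent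
  to a combinatorial exchange property of \<open>M\<close>: for \<open>u \<in> M\<close> and \<open>i < j\<close>, deleting \<open>x\<^sub>j\<close> from \<open>u\<close> and
  multiplying by a high power of \<open>x\<^sub>i\<close> stays in \<open>M\<close>. For (1) this is immediate, because \<open>f\<close> is in the
  saturation by \<open>(x\<^sub>1,\<dots>,x\<^sub>j)\<close> iff each \<open>x\<^sub>i\<close> with \<open>i \<le> j\<close> has a power multiplying \<open>f\<close> into \<open>I\<close>.
  The same criterion shows that, under (1), the set of variables in an associated prime is an initial
  segment, and a leading-term argument shows that these variables generate it. Conversely, a failure
  of the exchange property for \<open>(i, j)\<close> produces a monomial whose annihilator modulo \<open>I\<close> is generated
  by variables including \<open>x\<^sub>j\<close> but not \<open>x\<^sub>i\<close>. For (3), the bound \<open>q(I)\<close> makes a pigeonhole argument work.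
\<close>

section \<open>Saturations and associated primes in a commutative ring\<close>

text \<open>Applied with a power of \<open>Idl X\<close> as \<open>S\<close>: because the
  multipliers form an ideal, checking the generators \<open>X\<close> is enough for all of
  \<open>Idl X\<close>.\<close>

lemma (in cring) ideal_multiplier:
  assumes I: "ideal I R" and f: "f \<in> carrier R" and S: "ideal S R"
  shows "ideal {g \<in> carrier R. \<forall>h\<in>S. g \<otimes> f \<otimes> h \<in> I} R"
proof (rule idealI)
  interpret I: ideal I R by fact
  interpret S: ideal S R by fact
  let ?A = "{g \<in> carrier R. \<forall>h\<in>S. g \<otimes> f \<otimes> h \<in> I}"
  show "ring R" by (rule ring_axioms)
  show "subgroup ?A (add_monoid R)"
  proof (rule add.subgroupI)
    have "\<zero> \<in> ?A" using f by (auto simp: S.Icarr)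
    then show "?A \<noteq> {}" by blast
  next
    fix a assume "a \<in> ?A"
    then show "\<ominus> a \<in> ?A" using f by (auto simp: l_minus S.Icarr)
  next
    fix a b assume "a \<in> ?A" "b \<in> ?A"
    then show "a \<oplus> b \<in> ?A" using f by (auto simp: l_distr S.Icarr)
  qed auto
  fix a x assume a: "a \<in> ?A" and x: "x \<in> carrier R"
  have "x \<otimes> a \<otimes> f \<otimes> h \<in> I" if "h \<in> S" for h
  proof -
    have "x \<otimes> (a \<otimes> f \<otimes> h) \<in> I" using a x that by (auto intro: I.I_l_closed)
    then show ?thesis using a x f that by (simp add: m_assoc S.Icarr)
  qed
  then show "x \<otimes> a \<in> ?A" using a x by auto
  then show "a \<otimes> x \<in> ?A" using a x m_comm by auto
qed

lemma (in ring) mult_ideals_set: "I \<otimes>\<^bsub>ideals_set R\<^esub> J = I \<cdot> J"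
  by (simp add: ideals_set_def)

lemma (in cring) ideal_ideal_pow:
  assumes "ideal J R" shows "ideal (J [^]\<^bsub>ideals_set R\<^esub> (k::nat)) R"
proof (induction k)
  case 0
  then show ?case using oneideal by (simp add: ideals_set_def)
next
  case (Suc k)
  then show ?case using assms by (simp add: mult_ideals_set ideal_prod_is_ideal)
qed

lemma (in cring) pow_in_ideal_pow:
  assumes "ideal J R" "x \<in> J"
  shows "x [^] (k::nat) \<in> J [^]\<^bsub>ideals_set R\<^esub> k"
proof (induction k)
  case 0
  then show ?case by (simp add: ideals_set_def)
next
  case (Suc k)
  then show ?case
    using assms by (auto simp: mult_ideals_set intro: ideal_prod.prod)
qed

text \<open>Induction on the total exponent \<open>s\<close>: multiplying \<open>f\<close> by any generator lowers it by one.\<close>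

lemma (in cring) ideal_colon_pow_genideal:
  assumes I: "ideal I R" and X: "X \<subseteq> carrier R" "finite X"
  shows "f \<in> carrier R \<Longrightarrow> (\<And>x. x \<in> X \<Longrightarrow> f \<otimes> x [^] (k x :: nat) \<in> I) \<Longrightarrow> sum k X = s \<Longrightarrow>
    f \<in> ideal_colon R I (Idl X [^]\<^bsub>ideals_set R\<^esub> Suc s)"
proof (induction s arbitrary: f k rule: less_induct)
  case (less s)
  interpret I: ideal I R by fact
  let ?J = "Idl X"
  let ?P = "\<lambda>s. ?J [^]\<^bsub>ideals_set R\<^esub> (s::nat)"
  have J: "ideal ?J R" using X(1) by (rule genideal_ideal)
  have P: "ideal (?P m) R" for m by (rule ideal_ideal_pow[OF J])
  show ?case
  \<comment> \<open>If some \<open>k x\<close> is 0 then \<open>f\<close> already lies in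
    \<open>I\<close>, so outside this case the truncated \<open>k x - 1\<close> is a true
    decrement.\<close>
  proof (cases "f \<in> I")
    case True
    then show ?thesis
      using less.prems(1) ideal.Icarr[OF P] I.I_r_closed unfolding ideal_colon_def by blast
  next
    case False
    have step: "x \<otimes> f \<otimes> h \<in> I" if x: "x \<in> X" and h: "h \<in> ?P s" for x h
    proof -
      have kx: "k x \<noteq> 0"
      proof
        assume "k x = 0"
        then have "f \<in> I" using less.prems(2)[OF x] less.prems(1) by simp
        then show False using False by simp
      qed
      have xc: "x \<in> carrier R" using x X by auto
      have "f \<otimes> x \<otimes> y [^] (k(x := k x - 1)) y \<in> I" if y: "y \<in> X" for y
      proof (cases "y = x")
        case True
        have "f \<otimes> x [^] Suc (k x - 1) \<in> I" using less.prems(2)[OF x] kx by simp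
        moreover have "f \<otimes> x [^] Suc (k x - 1) = f \<otimes> x \<otimes> x [^] (k x - 1)"
          using xc less.prems(1) m_comm[of x "x [^] (k x - 1)"] by (simp add: m_assoc)
        ultimately show ?thesis using True by simp
      next
        case False
        have yc: "y \<in> carrier R" using y X by auto
        have "x \<otimes> (f \<otimes> y [^] k y) \<in> I" using less.prems(2)[OF y] xc by (rule I.I_l_closed)
        moreover have "x \<otimes> (f \<otimes> y [^] k y) = f \<otimes> x \<otimes> y [^] k y"
          using xc yc less.prems(1) by (simp add: m_ac)
        ultimately show ?thesis using False by simp
      qed
      \<comment> \<open>The induction hypothesis gives the power \<open>Suc\<close> of the lowered
        total, which is exactly \<open>s\<close>, one less than the power claimed for
        \<open>f\<close>.\<close>
      moreover have sum: "Suc (sum (k(x := k x - 1)) X) = s"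
        using kx x X less.prems(3) by (simp add: sum.remove[OF X(2) x])
      ultimately have "f \<otimes> x \<in> ideal_colon R I (?P (Suc (sum (k(x := k x - 1)) X)))"
        using less.IH[of "sum (k(x := k x - 1)) X" "f \<otimes> x" "k(x := k x - 1)"] less.prems(1) xc
        by (simp del: fun_upd_apply)
      then have "f \<otimes> x \<otimes> h \<in> I" using h unfolding sum by (simp add: ideal_colon_def)
      then show ?thesis using xc less.prems(1) by (simp add: m_comm)
    qed
    define T where "T = {g \<in> carrier R. \<forall>h\<in>?P s. g \<otimes> f \<otimes> h \<in> I}"
    have "ideal T R" unfolding T_def by (rule ideal_multiplier[OF I less.prems(1) P])
    moreover have "X \<subseteq> T" using step X by (auto simp: T_def)
    ultimately have JT: "?J \<subseteq> T" by (rule genideal_minimal)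
    have "f \<otimes> g \<in> I" if "g \<in> ?P s \<cdot> ?J" for g
      using that
    proof induction
      case (prod i j)
      then have "j \<otimes> f \<otimes> i \<in> I" using JT by (auto simp: T_def)
      moreover have "j \<otimes> f \<otimes> i = f \<otimes> (i \<otimes> j)"
        using less.prems(1) ideal.Icarr[OF P prod(1)] ideal.Icarr[OF J prod(2)] by (simp add: m_ac)
      ultimately show ?case by simp
    next
      case (sum s1 s2)
      then show ?case
        using less.prems(1) ideal_prod_in_carrier[OF P J] by (auto simp: r_distr subset_iff)
    qed
    then show ?thesis using less.prems(1) by (simp add: ideal_colon_def mult_ideals_set)
  qed
qed

text \<open>Exponents chosen for the finitely many generators add up to a single power of the ideal
  that works; the \<open>Suc\<close> there also meets the range \<open>k \<ge> 1\<close> in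
  \<open>ideal_saturation\<close>.\<close>

lemma (in cring) ideal_saturation_genideal_iff:
  assumes I: "ideal I R" and X: "X \<subseteq> carrier R" "finite X"
  shows "f \<in> ideal_saturation R I (Idl X) \<longleftrightarrow>
    f \<in> carrier R \<and> (\<forall>x\<in>X. \<exists>k::nat. f \<otimes> x [^] k \<in> I)"
proof
  assume "f \<in> ideal_saturation R I (Idl X)"
  moreover have "x [^] (k::nat) \<in> Idl X [^]\<^bsub>ideals_set R\<^esub> k" if "x \<in> X" for x k
    using that pow_in_ideal_pow[OF genideal_ideal[OF X(1)]] genideal_self[OF X(1)] by blast
  ultimately show "f \<in> carrier R \<and> (\<forall>x\<in>X. \<exists>k::nat. f \<otimes> x [^] k \<in> I)"
    unfolding ideal_saturation_def ideal_colon_def by blast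
next
  assume "f \<in> carrier R \<and> (\<forall>x\<in>X. \<exists>k::nat. f \<otimes> x [^] k \<in> I)"
  then obtain k where "f \<in> carrier R" "\<And>x. x \<in> X \<Longrightarrow> f \<otimes> x [^] (k x :: nat) \<in> I" by metis
  then have "f \<in> ideal_colon R I (Idl X [^]\<^bsub>ideals_set R\<^esub> Suc (sum k X))"
    using ideal_colon_pow_genideal[OF I X] by blast
  moreover have "Suc (sum k X) \<in> {1..}" by simp
  ultimately show "f \<in> ideal_saturation R I (Idl X)" unfolding ideal_saturation_def by blast
qed

text \<open>A product of cosets is the coset of the product, and it vanishes iff the representative
  lies in \<open>I\<close>. This removes the quotient ring from all later arguments.\<close>

lemma (in cring) associated_primes_iff:
  assumes I: "ideal I R"
  shows "P \<in> associated_primes R I \<longleftrightarrow>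
    primeideal P R \<and> (\<exists>f\<in>carrier R. P = {a \<in> carrier R. a \<otimes> f \<in> I})"
proof -
  interpret I: ideal I R by fact
  have "{a \<in> carrier R. (I +> a) \<otimes>\<^bsub>R Quot I\<^esub> (I +> f) = \<zero>\<^bsub>R Quot I\<^esub>} = {a \<in> carrier R. a \<otimes> f \<in> I}"
    if f: "f \<in> carrier R" for f
  proof -
    have "(I +> a) \<otimes>\<^bsub>R Quot I\<^esub> (I +> f) = \<zero>\<^bsub>R Quot I\<^esub> \<longleftrightarrow> a \<otimes> f \<in> I" if "a \<in> carrier R" for a
      using that f I.a_rcos_self[of "a \<otimes> f"] I.a_rcos_const[of "a \<otimes> f"]
      by (auto simp: FactRing_def I.rcoset_mult_add)
    then show ?thesis by auto
  qed
  moreover have "carrier (R Quot I) = (\<lambda>f. I +> f) ` carrier R"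
    by (auto simp: FactRing_def A_RCOSETS_def')
  ultimately show ?thesis unfolding associated_primes_def by auto
qed

section \<open>Monomial ideals and their exponent sets\<close>

abbreviation expo :: "monom \<Rightarrow> nat \<Rightarrow> nat"
  where "expo \<equiv> Poly_Mapping.lookup"

text \<open>A monoid ideal of \<open>monoms n\<close>, that is, an up-set for divisibility. Monomial
  ideals are handled as the sets of polynomials supported in one.\<close>

definition monomial_filter :: "nat \<Rightarrow> monom set \<Rightarrow> bool"
  where "monomial_filter n M \<longleftrightarrow> M \<subseteq> monoms n \<and> (\<forall>u\<in>M. \<forall>c\<in>monoms n. u + c \<in> M)"

text \<open>Leaving the exponent of \<open>w\<close> at \<open>i\<close> free encodes the
  unspecified power of \<open>x_i\<close>; inequalities at the other indices suffice because the
  sets considered are upward closed.\<close>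

definition exchange :: "nat \<Rightarrow> monom set \<Rightarrow> bool"
  where "exchange n M \<longleftrightarrow>
    (\<forall>u\<in>M. \<forall>j\<in>{1..n}. \<forall>i\<in>{1..<j}. \<exists>w\<in>M. expo w j = 0 \<and> (\<forall>l. l \<noteq> i \<longrightarrow> expo w l \<le> expo u l))"

lemma monoms_iff: "u \<in> monoms n \<longleftrightarrow> (\<forall>l. expo u l \<noteq> 0 \<longrightarrow> 1 \<le> l \<and> l \<le> n)"
  by (auto simp: monoms_def in_keys_iff subset_iff)

lemma single_in_monoms: "1 \<le> i \<Longrightarrow> i \<le> n \<Longrightarrow> Poly_Mapping.single i k \<in> monoms n"
  by (auto simp: monoms_iff lookup_single when_def)

lemma monom_dvd_iff: "(\<exists>c. u = b + c) \<longleftrightarrow> (\<forall>l. expo b l \<le> expo u l)" for u b :: monom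
proof
  assume "\<forall>l. expo b l \<le> expo u l"
  then have "u = b + (u - b)" by (intro poly_mapping_eqI) (simp add: lookup_add lookup_minus)
  then show "\<exists>c. u = b + c" by blast
qed (auto simp: lookup_add)

lemma monomial_filter_upward:
  assumes M: "monomial_filter n M" and "u \<in> M" "v \<in> monoms n" "\<And>l. expo u l \<le> expo v l"
  shows "v \<in> M"
proof -
  obtain c where c: "v = u + c" using monom_dvd_iff assms(4) by blast
  then have "c \<in> monoms n" using assms(3) by (auto simp: monoms_iff lookup_add)
  then show ?thesis using M assms(2) c by (auto simp: monomial_filter_def)
qed

section \<open>Supports and coefficients of products\<close>

lemma keys_mon [simp]: "Poly_Mapping.keys (mon u :: monom \<Rightarrow>\<^sub>0 'k::field) = {u}"
  by (simp add: mon_def)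

lemma keys_minus_single:
  fixes p :: "'a \<Rightarrow>\<^sub>0 'b::ab_group_add"
  shows "Poly_Mapping.keys (p - Poly_Mapping.single t (Poly_Mapping.lookup p t)) = Poly_Mapping.keys p - {t}"
  by (auto simp: in_keys_iff lookup_minus lookup_single when_def split: if_splits)

text \<open>Only one pair of terms contributes to \<open>s + t\<close>, so nothing cancels. The main
  use is with \<open>s\<close> and \<open>t\<close> maximal in a term order.\<close>

lemma lookup_mult_unique:
  fixes p q :: "monom \<Rightarrow>\<^sub>0 'k::field"
  assumes unique: "\<And>a b. a \<in> Poly_Mapping.keys p \<Longrightarrow> b \<in> Poly_Mapping.keys q \<Longrightarrow> a + b = s + t \<Longrightarrow> a = s \<and> b = t"
    and st: "s \<in> Poly_Mapping.keys p" "t \<in> Poly_Mapping.keys q"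
  shows "Poly_Mapping.lookup (p * q) (s + t) = Poly_Mapping.lookup p s * Poly_Mapping.lookup q t"
proof -
  define p' where "p' = p - Poly_Mapping.single s (Poly_Mapping.lookup p s)"
  define q' where "q' = q - Poly_Mapping.single t (Poly_Mapping.lookup q t)"
  \<comment> \<open>With one term split off each factor, the product of the two split terms carries
    the whole coefficient, as \<open>s + t\<close> misses the supports of the other
    summands.\<close>
  have "p * q = Poly_Mapping.single s (Poly_Mapping.lookup p s) * Poly_Mapping.single t (Poly_Mapping.lookup q t)
      + Poly_Mapping.single s (Poly_Mapping.lookup p s) * q' + p' * q"
    by (simp add: p'_def q'_def algebra_simps)
  moreover have "s + t \<notin> Poly_Mapping.keys (Poly_Mapping.single s (Poly_Mapping.lookup p s) * q')"
    using Poly_Mapping.keys_mult[of "Poly_Mapping.single s (Poly_Mapping.lookup p s)" q'] unique st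
    unfolding q'_def keys_minus_single by (fastforce split: if_splits)
  moreover have "s + t \<notin> Poly_Mapping.keys (p' * q)"
    using Poly_Mapping.keys_mult[of p' q] unique unfolding p'_def keys_minus_single by force
  ultimately show ?thesis by (simp add: lookup_add in_keys_iff Poly_Mapping.mult_single)
qed

lemma keys_times_mon:
  fixes p :: "monom \<Rightarrow>\<^sub>0 'k::field"
  shows "Poly_Mapping.keys (p * mon u) = (\<lambda>v. v + u) ` Poly_Mapping.keys p"
proof
  show "Poly_Mapping.keys (p * mon u) \<subseteq> (\<lambda>v. v + u) ` Poly_Mapping.keys p"
    using Poly_Mapping.keys_mult[of p "mon u"] by (auto simp: mon_def)
  have "Poly_Mapping.lookup (p * mon u) (v + u) = Poly_Mapping.lookup p v" if "v \<in> Poly_Mapping.keys p" for v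
    using that by (subst lookup_mult_unique) (simp_all add: mon_def)
  then show "(\<lambda>v. v + u) ` Poly_Mapping.keys p \<subseteq> Poly_Mapping.keys (p * mon u)"
    by (auto simp: in_keys_iff)
qed

lemma mpoly_ring_simps [simp]:
  "carrier (mpoly_ring n) = {p. Poly_Mapping.keys p \<subseteq> monoms n}"
  "mult (mpoly_ring n) = (*)" "one (mpoly_ring n) = 1" "zero (mpoly_ring n) = 0" "add (mpoly_ring n) = (+)"
  by (simp_all add: mpoly_ring_def)

lemma pow_mpoly_ring: "p [^]\<^bsub>mpoly_ring n\<^esub> (k::nat) = p ^ k"
  by (induction k) (simp_all add: mult.commute)

lemma mon_mult: "mon u * mon v = (mon (u + v) :: monom \<Rightarrow>\<^sub>0 'k::field)"
  by (simp add: mon_def Poly_Mapping.mult_single)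

lemma var_pow: "var i ^ k = (mon (Poly_Mapping.single i k) :: monom \<Rightarrow>\<^sub>0 'k::field)"
proof (induction k)
  case 0
  then show ?case by (simp add: mon_def)
next
  case (Suc k)
  have "var i ^ Suc k = (mon (var_exp i) * mon (Poly_Mapping.single i k) :: monom \<Rightarrow>\<^sub>0 'k)"
    using Suc by (simp add: var_def)
  also have "\<dots> = mon (Poly_Mapping.single i (Suc k))"
    unfolding mon_mult by (simp flip: single_add)
  finally show ?case .
qed

lemma poly_mapping_sum_singles:
  "p = (\<Sum>v\<in>Poly_Mapping.keys p. Poly_Mapping.single v (Poly_Mapping.lookup p v))"
  by (rule poly_mapping_eqI)
    (auto simp: lookup_sum lookup_single when_def in_keys_iff sum.delta'[where b="Poly_Mapping.lookup p"])

section \<open>Ideals generated by monomials\<close>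

lemma ideal_keys_in_filter:
  assumes M: "monomial_filter n M"
  shows "ideal {p :: monom \<Rightarrow>\<^sub>0 'k::field. Poly_Mapping.keys p \<subseteq> M} (mpoly_ring n)"
proof (rule idealI)
  interpret R: cring "mpoly_ring n :: (monom \<Rightarrow>\<^sub>0 'k) ring" by (rule mpoly_ring_cring)
  let ?R = "mpoly_ring n :: (monom \<Rightarrow>\<^sub>0 'k) ring"
  let ?T = "{p :: monom \<Rightarrow>\<^sub>0 'k. Poly_Mapping.keys p \<subseteq> M}"
  show "ring ?R" by (rule R.ring_axioms)
  have Mn: "M \<subseteq> monoms n" using M by (simp add: monomial_filter_def)
  show "subgroup ?T (add_monoid ?R)"
  proof (rule R.add.subgroupI)
    show "?T \<subseteq> carrier ?R" using Mn by auto
    have "0 \<in> ?T" by simp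
    then show "?T \<noteq> {}" by blast
  next
    fix p assume p: "p \<in> ?T"
    then have "\<ominus>\<^bsub>?R\<^esub> p = - p" using Mn by (intro R.minus_equality) auto
    then show "\<ominus>\<^bsub>?R\<^esub> p \<in> ?T" using p by simp
  next
    fix p q assume "p \<in> ?T" "q \<in> ?T"
    then show "p \<oplus>\<^bsub>?R\<^esub> q \<in> ?T" using Poly_Mapping.keys_add[of p q] by auto
  qed
  fix p x assume p: "p \<in> ?T" and x: "x \<in> carrier ?R"
  have "b + a \<in> M" if "b \<in> Poly_Mapping.keys p" "a \<in> Poly_Mapping.keys x" for a b
    using that p x M by (simp add: monomial_filter_def subset_iff)
  then show "p \<otimes>\<^bsub>?R\<^esub> x \<in> ?T" using Poly_Mapping.keys_mult[of p x] by fastforce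
  then show "x \<otimes>\<^bsub>?R\<^esub> p \<in> ?T" by (simp add: mult.commute)
qed

text \<open>Polynomials supported in \<open>M\<close> form an ideal containing the generators;
  conversely, such a polynomial is a sum of constants times monomials of the ideal. Membership thus
  becomes a condition on supports.\<close>

lemma genideal_mon_eq:
  assumes A: "A \<subseteq> monoms n"
  defines "M \<equiv> {u \<in> monoms n. \<exists>a\<in>A. \<exists>c. u = a + c}"
  shows "monomial_filter n M"
    and "Idl\<^bsub>mpoly_ring n\<^esub> (mon ` A) = {p :: monom \<Rightarrow>\<^sub>0 'k::field. Poly_Mapping.keys p \<subseteq> M}"
proof -
  interpret R: cring "mpoly_ring n :: (monom \<Rightarrow>\<^sub>0 'k) ring" by (rule mpoly_ring_cring)
  let ?R = "mpoly_ring n :: (monom \<Rightarrow>\<^sub>0 'k) ring"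
  show M: "monomial_filter n M"
    unfolding monomial_filter_def M_def by (auto simp: monoms_add) (metis add.assoc)
  have sub: "(mon ` A :: (monom \<Rightarrow>\<^sub>0 'k) set) \<subseteq> carrier ?R" using A by auto
  interpret I: ideal "Idl\<^bsub>?R\<^esub> (mon ` A)" ?R by (rule R.genideal_ideal[OF sub])
  show "Idl\<^bsub>?R\<^esub> (mon ` A) = {p. Poly_Mapping.keys p \<subseteq> M}"
  proof
    have "A \<subseteq> M" using A unfolding M_def by (auto intro!: exI[of _ 0])
    then show "Idl\<^bsub>?R\<^esub> (mon ` A) \<subseteq> {p. Poly_Mapping.keys p \<subseteq> M}"
      by (intro R.genideal_minimal ideal_keys_in_filter[OF M]) auto
  next
    show "{p. Poly_Mapping.keys p \<subseteq> M} \<subseteq> Idl\<^bsub>?R\<^esub> (mon ` A)"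
    proof safe
      fix p :: "monom \<Rightarrow>\<^sub>0 'k" assume p: "Poly_Mapping.keys p \<subseteq> M"
      have single: "Poly_Mapping.single v c \<in> Idl\<^bsub>?R\<^esub> (mon ` A)" if v: "v \<in> M" for v and c :: 'k
      proof -
        have "mon v \<in> Idl\<^bsub>?R\<^esub> (mon ` A)"
          using v mon_in_genideal_iff[OF A, where 'k = 'k] by (auto simp: M_def)
        moreover have "Poly_Mapping.single 0 c \<in> carrier ?R" by (simp add: monoms_def)
        ultimately have "Poly_Mapping.single 0 c \<otimes>\<^bsub>?R\<^esub> mon v \<in> Idl\<^bsub>?R\<^esub> (mon ` A)"
          by (rule I.I_l_closed)
        then show ?thesis by (simp add: mon_def Poly_Mapping.mult_single)
      qed
      have closed: "sum f B \<in> Idl\<^bsub>?R\<^esub> (mon ` A)" if "finite B" "\<And>v. v \<in> B \<Longrightarrow> f v \<in> Idl\<^bsub>?R\<^esub> (mon ` A)"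
        for f and B :: "monom set"
        using that I.zero_closed I.a_closed by (induction B rule: finite_induct) auto
      then show "p \<in> Idl\<^bsub>?R\<^esub> (mon ` A)"
        using single p by (subst poly_mapping_sum_singles, intro closed) auto
    qed
  qed
qed

lemma monomial_ideal_filter:
  fixes I :: "(monom \<Rightarrow>\<^sub>0 'k::field) set"
  assumes "monomial_ideal n I"
  obtains M where "monomial_filter n M" "I = {p. Poly_Mapping.keys p \<subseteq> M}"
proof -
  obtain A where A: "A \<subseteq> monoms n" "I = Idl\<^bsub>mpoly_ring n\<^esub> (mon ` A)"
    using assms by (auto simp: monomial_ideal_def)
  show ?thesis
    using that[OF genideal_mon_eq(1)[OF A(1)]] genideal_mon_eq(2)[OF A(1), where 'k = 'k] A(2) by simp
qed

lemma genideal_vars: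
  assumes "V \<subseteq> {1..n}"
  shows "Idl\<^bsub>mpoly_ring n\<^esub> (var ` V) =
    {p :: monom \<Rightarrow>\<^sub>0 'k::field. \<forall>u\<in>Poly_Mapping.keys p. u \<in> monoms n \<and> (\<exists>l\<in>V. expo u l \<noteq> 0)}"
proof -
  have "var_exp ` V \<subseteq> monoms n" using assms by (auto intro!: single_in_monoms)
  moreover have "mon ` var_exp ` V = (var ` V :: (monom \<Rightarrow>\<^sub>0 'k) set)"
    by (simp add: var_def image_image)
  moreover have "(\<exists>c. u = var_exp l + c) \<longleftrightarrow> expo u l \<noteq> 0" for u l
    unfolding monom_dvd_iff by (auto simp: lookup_single when_def Suc_le_eq)
  ultimately show ?thesis
    using genideal_mon_eq(2)[of "var_exp ` V" n, where 'k = 'k] by auto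
qed

section \<open>Monomials with prescribed exponents, and degrees\<close>

lemma monom_with_exponents:
  fixes f :: "nat \<Rightarrow> nat"
  shows "\<exists>u\<in>monoms n. \<forall>l. expo u l = (if l \<in> {1..n} then f l else 0)"
proof -
  define u where "u = (\<Sum>l\<in>{1..n}. Poly_Mapping.single l (f l))"
  have "expo u l = (if l \<in> {1..n} then f l else 0)" for l
    by (simp add: u_def lookup_sum lookup_single when_def)
  then show ?thesis by (intro bexI[of _ u]) (auto simp: monoms_iff split: if_splits)
qed

lemma mdegree_eq_sum: "u \<in> monoms n \<Longrightarrow> mdegree u = (\<Sum>l\<in>{1..n}. expo u l)"
  unfolding mdegree_def by (rule sum.mono_neutral_left) (auto simp: monoms_def in_keys_iff)

lemma expo_le_mdegree: "expo u l \<le> mdegree u"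
proof (cases "l \<in> Poly_Mapping.keys u")
  case True
  then show ?thesis unfolding mdegree_def by (intro member_le_sum) auto
qed (simp add: in_keys_iff)

lemma mdegree_single [simp]: "mdegree (Poly_Mapping.single l k) = k"
  by (cases "k = 0") (simp_all add: mdegree_def)

section \<open>Finiteness of the minimal generators\<close>

text \<open>Every sequence has a monotone subsequence, and a decreasing one of naturals is constant
  once its minimum is attained.\<close>

lemma nat_seq_incseq_subseq:
  fixes s :: "nat \<Rightarrow> nat"
  obtains r where "strict_mono r" "incseq (\<lambda>k. s (r k))"
proof -
  obtain r where r: "strict_mono r" "monoseq (\<lambda>k. s (r k))" using seq_monosub by blast
  show ?thesis
  proof (cases "incseq (\<lambda>k. s (r k))")
    case True
    then show ?thesis using that r by blast
  next
    case False
    then have dec: "decseq (\<lambda>k. s (r k))" using r(2) by (auto simp: monoseq_iff)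
    obtain k0 where k0: "\<And>k. s (r k0) \<le> s (r k)"
      using ex_has_least_nat[of "\<lambda>_. True" _ "\<lambda>k. s (r k)"] by blast
    have "s (r (k0 + k)) = s (r k0)" for k
      using k0[of "k0 + k"] decseqD[OF dec, of k0 "k0 + k"] by simp
    then have "incseq (\<lambda>k. s (r (k0 + k)))" by (simp add: incseq_def)
    moreover have "strict_mono (\<lambda>k. r (k0 + k))" using r(1) by (simp add: strict_mono_def)
    ultimately show ?thesis using that[of "\<lambda>k. r (k0 + k)"] by simp
  qed
qed

text \<open>Coordinates are treated one at a time; thinning the sequence further keeps the earlier
  ones increasing.\<close>

lemma nat_seqs_incseq_subseq:
  fixes s :: "nat \<Rightarrow> 'a \<Rightarrow> nat"
  assumes "finite V"
  shows "\<exists>r. strict_mono r \<and> (\<forall>l\<in>V. incseq (\<lambda>k. s (r k) l))"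
  using assms
proof (induction V rule: finite_induct)
  case empty
  show ?case by (rule exI[of _ id]) (simp add: strict_mono_def)
next
  case (insert a V)
  then obtain r where r: "strict_mono r" "\<forall>l\<in>V. incseq (\<lambda>k. s (r k) l)" by blast
  obtain r' where r': "strict_mono r'" "incseq (\<lambda>k. s (r (r' k)) a)"
    using nat_seq_incseq_subseq[of "\<lambda>k. s (r k) a"] by blast
  have "incseq (\<lambda>k. s (r (r' k)) l)" if "l \<in> V" for l
    using r(2) that strict_mono_mono[OF r'(1)] by (auto simp: incseq_def mono_def)
  moreover have "strict_mono (\<lambda>k. r (r' k))" using r(1) r'(1) by (simp add: strict_mono_def)
  ultimately show ?case using r' by (intro exI[of _ "\<lambda>k. r (r' k)"]) auto
qed

text \<open>Dickson's lemma: an injective sequence in an infinite \<open>A\<close> would have a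
  subsequence increasing in all \<open>n\<close> coordinates, whose first two members would be
  comparable and hence equal.\<close>

lemma dickson_antichain_finite:
  assumes A: "A \<subseteq> monoms n"
    and anti: "\<And>u v. u \<in> A \<Longrightarrow> v \<in> A \<Longrightarrow> (\<And>l. expo u l \<le> expo v l) \<Longrightarrow> u = v"
  shows "finite A"
proof (rule ccontr)
  assume "infinite A"
  then obtain f :: "nat \<Rightarrow> monom" where f: "inj f" "range f \<subseteq> A"
    using infinite_countable_subset by blast
  obtain r where r: "strict_mono r" "\<forall>l\<in>{1..n}. incseq (\<lambda>k. expo (f (r k)) l)"
    using nat_seqs_incseq_subseq[of "{1..n}" "\<lambda>k. expo (f k)"] by auto
  have "expo (f (r 0)) l \<le> expo (f (r 1)) l" for l
  proof (cases "l \<in> {1..n}")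
    case True
    then show ?thesis using r(2) by (auto simp: incseq_def)
  next
    case False
    have "f (r 0) \<in> monoms n" using f A by blast
    then show ?thesis using False by (metis monoms_iff atLeastAtMost_iff le0)
  qed
  then have "f (r 0) = f (r 1)" using anti f by blast
  then have "r 0 = r 1" using f(1) by (simp add: inj_eq)
  then show False using r(1) by (simp add: strict_mono_eq)
qed

text \<open>The only access to the minimal generators. Both bounds are defined with
  \<open>Max\<close>, so they are usable once Dickson's lemma has shown \<open>G\<close>
  finite.\<close>

lemma monomial_filter_bounded_gens:
  fixes I :: "(monom \<Rightarrow>\<^sub>0 'k::field) set"
  assumes I: "monomial_ideal n I" and M: "monomial_filter n M" "I = {p. Poly_Mapping.keys p \<subseteq> M}"
    and u: "u \<in> M"
  shows "\<exists>g\<in>M. (\<forall>l. expo g l \<le> expo u l) \<and> mdegree g \<le> ideal_deg n I \<and> max_var g \<le> ideal_max_var n I"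
proof -
  define G where "G = min_mon_gens n I"
  have memI: "mon v \<in> I \<longleftrightarrow> v \<in> M" for v using M(2) by simp
  have "is_min_mon_gens n I G"
    unfolding G_def min_mon_gens_def using min_mon_gens_unique[OF I]
    by (intro theI[where P = "is_min_mon_gens n I"]) auto
  then have G: "G \<subseteq> monoms n" "Idl\<^bsub>mpoly_ring n\<^esub> (mon ` G) = I"
    "G = {u \<in> monoms n. u \<in> M \<and> (\<forall>b c. u = b + c \<longrightarrow> b \<in> M \<longrightarrow> c = 0)}"
    using min_mon_gens_unique[OF I] memI by (auto simp: is_min_mon_gens_def)
  \<comment> \<open>If one minimal generator divides another, the cofactor is 1, so they form an
    antichain.\<close>
  have "finite G"
  proof (rule dickson_antichain_finite[OF G(1)])
    fix v w assume vw: "v \<in> G" "w \<in> G" "\<And>l. expo v l \<le> expo w l"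
    then obtain c where "w = v + c" using monom_dvd_iff by blast
    then show "v = w" using vw G(3) by auto
  qed
  moreover have "u \<in> monoms n" using u M(1) by (auto simp: monomial_filter_def)
  then obtain g where g: "g \<in> G" "\<exists>c. u = g + c"
    using mon_in_genideal_iff[OF G(1), where 'k = 'k] G(2) memI u by blast
  ultimately show ?thesis
    using G(3) monom_dvd_iff[of u g]
    unfolding ideal_deg_def ideal_max_var_def G_def[symmetric] by (intro bexI[of _ g]) auto
qed

section \<open>Borel type\<close>

text \<open>Multiplying by a power of \<open>x_i\<close> translates the support, and the sum of the
  powers needed by the finitely many terms of \<open>f\<close> works for all of them. Saturation can
  thus be tested monomial by monomial.\<close>

lemma saturation_vars_iff:
  fixes f :: "monom \<Rightarrow>\<^sub>0 'k::field"
  assumes M: "monomial_filter n M" and V: "V \<subseteq> {1..n}"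
  shows "f \<in> ideal_saturation (mpoly_ring n) {p. Poly_Mapping.keys p \<subseteq> M} (Idl\<^bsub>mpoly_ring n\<^esub> (var ` V)) \<longleftrightarrow>
    Poly_Mapping.keys f \<subseteq> monoms n \<and>
    (\<forall>i\<in>V. \<forall>v\<in>Poly_Mapping.keys f. \<exists>k. v + Poly_Mapping.single i k \<in> M)"
proof -
  interpret R: cring "mpoly_ring n :: (monom \<Rightarrow>\<^sub>0 'k) ring" by (rule mpoly_ring_cring)
  let ?R = "mpoly_ring n :: (monom \<Rightarrow>\<^sub>0 'k) ring"
  have X: "(var ` V :: (monom \<Rightarrow>\<^sub>0 'k) set) \<subseteq> carrier ?R" "finite (var ` V :: (monom \<Rightarrow>\<^sub>0 'k) set)"
    using V finite_subset[OF V] by (auto simp: var_def single_in_monoms)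
  have "(\<exists>k. \<forall>v\<in>Poly_Mapping.keys f. v + Poly_Mapping.single i k \<in> M) \<longleftrightarrow>
    (\<forall>v\<in>Poly_Mapping.keys f. \<exists>k. v + Poly_Mapping.single i k \<in> M)" if i: "i \<in> V" for i
  proof
    assume "\<forall>v\<in>Poly_Mapping.keys f. \<exists>k. v + Poly_Mapping.single i k \<in> M"
    then obtain k where k: "\<And>v. v \<in> Poly_Mapping.keys f \<Longrightarrow> v + Poly_Mapping.single i (k v) \<in> M"
      by metis
    define K where "K = sum k (Poly_Mapping.keys f)"
    have "v + Poly_Mapping.single i K \<in> M" if v: "v \<in> Poly_Mapping.keys f" for v
    proof -
      have "k v \<le> K" unfolding K_def using v by (intro member_le_sum) auto
      then have "Poly_Mapping.single i K = Poly_Mapping.single i (k v) + Poly_Mapping.single i (K - k v)"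
        by (simp flip: single_add)
      moreover have "Poly_Mapping.single i (K - k v) \<in> monoms n"
        using i V by (auto intro!: single_in_monoms)
      ultimately show ?thesis
        using k[OF v] M by (auto simp: monomial_filter_def add.assoc[symmetric])
    qed
    then show "\<exists>k. \<forall>v\<in>Poly_Mapping.keys f. v + Poly_Mapping.single i k \<in> M" by blast
  qed blast
  moreover have "f * var i ^ k \<in> {p. Poly_Mapping.keys p \<subseteq> M} \<longleftrightarrow>
    (\<forall>v\<in>Poly_Mapping.keys f. v + Poly_Mapping.single i k \<in> M)" for i k
    by (auto simp: var_pow keys_times_mon)
  ultimately show ?thesis
    unfolding R.ideal_saturation_genideal_iff[OF ideal_keys_in_filter[OF M] X]
    by (simp add: pow_mpoly_ring)
qed

text \<open>The bridge compares, for a single monomial \<open>v\<close>, the powers of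
  \<open>x_j\<close> and of \<open>x_i\<close> that carry \<open>v\<close> into \<open>M\<close>;
  \<open>exchange\<close> results from taking \<open>v\<close> to be \<open>u\<close> with
  \<open>x_j\<close> deleted.\<close>

lemma borel_type_iff_exchange:
  assumes M: "monomial_filter n M"
  shows "borel_type n {p :: monom \<Rightarrow>\<^sub>0 'k::field. Poly_Mapping.keys p \<subseteq> M} \<longleftrightarrow> exchange n M"
proof -
  have Mn: "M \<subseteq> monoms n" using M by (simp add: monomial_filter_def)
  have "borel_type n {p :: monom \<Rightarrow>\<^sub>0 'k. Poly_Mapping.keys p \<subseteq> M} \<longleftrightarrow>
    (\<forall>j\<in>{1..n}. \<forall>v\<in>monoms n. (\<exists>k. v + Poly_Mapping.single j k \<in> M) \<longrightarrow>
      (\<forall>i\<in>{1..j}. \<exists>k. v + Poly_Mapping.single i k \<in> M))" (is "?L \<longleftrightarrow> ?R")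
  proof
    assume L: ?L
    show ?R
    proof (intro ballI impI)
      fix j v i assume j: "j \<in> {1..n}" and v: "v \<in> monoms n" and i: "i \<in> {1..j}"
        and "\<exists>k. v + Poly_Mapping.single j k \<in> M"
      then have "mon v \<in> ideal_saturation (mpoly_ring n) {p :: monom \<Rightarrow>\<^sub>0 'k. Poly_Mapping.keys p \<subseteq> M}
          (Idl\<^bsub>mpoly_ring n\<^esub> (var ` {j}))"
        by (subst saturation_vars_iff[OF M]) auto
      then have "mon v \<in> ideal_saturation (mpoly_ring n) {p :: monom \<Rightarrow>\<^sub>0 'k. Poly_Mapping.keys p \<subseteq> M}
          (Idl\<^bsub>mpoly_ring n\<^esub> (var ` {1..j}))"
        using L j by (simp add: borel_type_def)
      then show "\<exists>k. v + Poly_Mapping.single i k \<in> M"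
        using i j by (subst (asm) saturation_vars_iff[OF M]) auto
    qed
  next
    assume R: ?R
    show ?L
      unfolding borel_type_def
    proof (rule ballI, rule Set.set_eqI)
      fix j and f :: "monom \<Rightarrow>\<^sub>0 'k" assume j: "j \<in> {1..n}"
      then have s: "{j} \<subseteq> {1..n}" "{1..j} \<subseteq> {1..n}" and jj: "j \<in> {1..j}" by auto
      have v: "(\<forall>i\<in>{1..j}. \<exists>k. v + Poly_Mapping.single i k \<in> M) \<longleftrightarrow> (\<forall>i\<in>{j}. \<exists>k. v + Poly_Mapping.single i k \<in> M)"
        if "v \<in> monoms n" for v
        using R j jj that by blast
      have eq: "{var j} = var ` {j}" by simp
      show "f \<in> ideal_saturation (mpoly_ring n) {p. Poly_Mapping.keys p \<subseteq> M} (Idl\<^bsub>mpoly_ring n\<^esub> {var j}) \<longleftrightarrow>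
        f \<in> ideal_saturation (mpoly_ring n) {p. Poly_Mapping.keys p \<subseteq> M} (Idl\<^bsub>mpoly_ring n\<^esub> (var ` {1..j}))"
        unfolding eq saturation_vars_iff[OF M s(1)] saturation_vars_iff[OF M s(2)] using v by blast
    qed
  qed
  also have "?R \<longleftrightarrow> exchange n M"
  proof
    assume R: ?R
    show "exchange n M"
      unfolding exchange_def
    proof (intro ballI)
      fix u j i assume u: "u \<in> M" and j: "j \<in> {1..n}" and i: "i \<in> {1..<j}"
      have un: "u \<in> monoms n" using u Mn by blast
      obtain v where v: "v \<in> monoms n" "\<And>l. expo v l = (if l \<in> {1..n} then if l = j then 0 else expo u l else 0)"
        using monom_with_exponents[of n "\<lambda>l. if l = j then 0 else expo u l"] by auto
      have "u = v + Poly_Mapping.single j (expo u j)"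
        using un j by (intro poly_mapping_eqI) (auto simp: lookup_add lookup_single v(2) when_def monoms_iff)
      then have "\<exists>k. v + Poly_Mapping.single j k \<in> M" using u by metis
      moreover have "i \<in> {1..j}" using i by auto
      ultimately obtain k where k: "v + Poly_Mapping.single i k \<in> M" using R v(1) j by blast
      show "\<exists>w\<in>M. expo w j = 0 \<and> (\<forall>l. l \<noteq> i \<longrightarrow> expo w l \<le> expo u l)"
        using i by (intro bexI[OF _ k]) (auto simp: lookup_add lookup_single v(2) when_def)
    qed
  next
    assume E: "exchange n M"
    show ?R
    proof (intro ballI impI)
      fix j v i assume j: "j \<in> {1..n}" and v: "v \<in> monoms n" and i: "i \<in> {1..j}"
        and ex: "\<exists>k. v + Poly_Mapping.single j k \<in> M"
      show "\<exists>k. v + Poly_Mapping.single i k \<in> M"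
      proof (cases "i = j")
        case False
        then have i': "i \<in> {1..<j}" using i by auto
        obtain k where "v + Poly_Mapping.single j k \<in> M" using ex by blast
        then obtain w where w: "w \<in> M" "expo w j = 0"
          "\<And>l. l \<noteq> i \<Longrightarrow> expo w l \<le> expo (v + Poly_Mapping.single j k) l"
          using E j i' unfolding exchange_def by blast
        \<comment> \<open>This power makes \<open>w\<close> a divisor: at \<open>j\<close> the
          exponent of \<open>w\<close> is 0, and away from \<open>i\<close> and \<open>j\<close> it
          is bounded by that of \<open>v\<close>.\<close>
        have "v + Poly_Mapping.single i (expo w i) \<in> M"
        proof (rule monomial_filter_upward[OF M w(1)])
          show "v + Poly_Mapping.single i (expo w i) \<in> monoms n"
            using i j v by (intro monoms_add single_in_monoms) auto
          show "expo w l \<le> expo (v + Poly_Mapping.single i (expo w i)) l" for l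
            using w(2) w(3)[of l] by (cases "l = i"; cases "l = j") (auto simp: lookup_add lookup_single when_def)
        qed
        then show ?thesis by blast
      qed (use ex in simp)
    qed
  qed
  finally show ?thesis .
qed

section \<open>Associated primes of monomial ideals\<close>

text \<open>Addition is strictly monotone for the total order on monomials, so one strict inequality
  would spoil the equality of sums. This feeds maxima into
  \<open>lookup_mult_unique\<close>.\<close>

lemma monom_add_le_unique:
  fixes a b s t :: monom
  assumes "a + b = s + t" "a \<le> s" "b \<le> t"
  shows "a = s \<and> b = t"
  using assms by (metis add_le_less_mono add_less_le_mono less_irrefl order_le_less)

text \<open>Iterating \<open>lt(g) lt(f) \<in> I\<close> over the terms of \<open>f\<close>, from the top, for the lexicographic order.\<close>

lemma leading_monomial_annihilates:
  fixes f g :: "monom \<Rightarrow>\<^sub>0 'k::field"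
  assumes M: "monomial_filter n M"
    and g: "Poly_Mapping.keys g \<subseteq> monoms n" "g \<noteq> 0"
  shows "Poly_Mapping.keys f \<subseteq> monoms n \<Longrightarrow> Poly_Mapping.keys (g * f) \<subseteq> M \<Longrightarrow>
    \<exists>l. Poly_Mapping.keys (mon (Max (Poly_Mapping.keys g)) ^ l * f) \<subseteq> M"
proof (induction "card (Poly_Mapping.keys f)" arbitrary: f)
  case 0
  then have "f = 0" by simp
  then show ?case by simp
next
  case (Suc m)
  let ?I = "{p :: monom \<Rightarrow>\<^sub>0 'k. Poly_Mapping.keys p \<subseteq> M}"
  interpret I: ideal ?I "mpoly_ring n" by (rule ideal_keys_in_filter[OF M])
  define t where "t = Max (Poly_Mapping.keys g)"
  define s where "s = Max (Poly_Mapping.keys f)"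
  define c where "c = Poly_Mapping.lookup f s"
  define f' where "f' = f - Poly_Mapping.single s c"
  have t: "t \<in> Poly_Mapping.keys g" unfolding t_def using g(2) by (intro Max_in) auto
  have s: "s \<in> Poly_Mapping.keys f" unfolding s_def using Suc.hyps(2) by (intro Max_in) auto
  have "Poly_Mapping.lookup (g * f) (t + s) = Poly_Mapping.lookup g t * Poly_Mapping.lookup f s"
  proof (rule lookup_mult_unique[OF _ t s])
    fix a b assume ab: "a \<in> Poly_Mapping.keys g" "b \<in> Poly_Mapping.keys f" and eq: "a + b = t + s"
    show "a = t \<and> b = s"
      using eq by (rule monom_add_le_unique) (use ab in \<open>simp_all add: t_def s_def\<close>)
  qed
  then have ts: "t + s \<in> M" using t s Suc.prems(2) by (auto simp: in_keys_iff)
  have tn: "mon t \<in> carrier (mpoly_ring n :: (monom \<Rightarrow>\<^sub>0 'k) ring)" and gn: "g \<in> carrier (mpoly_ring n)"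
    using t g(1) by auto
  have pow: "mon t ^ l \<in> carrier (mpoly_ring n :: (monom \<Rightarrow>\<^sub>0 'k) ring)" for l
    using I.nat_pow_closed[OF tn, of l] by (simp only: pow_mpoly_ring)
  \<comment> \<open>\<open>mon t\<close> carries the top term of \<open>f\<close> into the ideal.
    What remains of \<open>mon t * f\<close> is \<open>mon t * f'\<close>, which has one term fewer
    and is still multiplied into the ideal by \<open>g\<close>.\<close>
  have top: "mon t * Poly_Mapping.single s c \<in> ?I"
    using ts by (auto simp: mon_def Poly_Mapping.mult_single)
  have "mon t * (g * f) \<in> ?I" using I.I_l_closed[OF _ tn, of "g * f"] Suc.prems(2) by simp
  moreover have "g * (mon t * Poly_Mapping.single s c) \<in> ?I" using I.I_l_closed[OF top gn] by simp
  moreover have "g * (mon t * f') = mon t * (g * f) + - (g * (mon t * Poly_Mapping.single s c))"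
    by (simp add: f'_def algebra_simps)
  ultimately have "g * (mon t * f') \<in> ?I"
    using Poly_Mapping.keys_add[of "mon t * (g * f)" "- (g * (mon t * Poly_Mapping.single s c))"] by auto
  then have gf': "Poly_Mapping.keys (g * (mon t * f')) \<subseteq> M" by simp
  have keys_f': "Poly_Mapping.keys f' = Poly_Mapping.keys f - {s}"
    unfolding f'_def c_def by (rule keys_minus_single)
  have keys: "Poly_Mapping.keys (mon t * f') = (\<lambda>v. v + t) ` Poly_Mapping.keys f'"
    using keys_times_mon[of f' t] by (simp add: mult.commute)
  have "card (Poly_Mapping.keys (mon t * f')) = m"
    unfolding keys using Suc.hyps(2) s by (subst card_image) (auto simp: keys_f' inj_on_def)
  moreover have "Poly_Mapping.keys (mon t * f') \<subseteq> monoms n"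
    unfolding keys using Suc.prems(1) keys_f' tn by (auto intro!: monoms_add)
  ultimately obtain l where l: "mon t ^ l * (mon t * f') \<in> ?I"
    using Suc.hyps(1)[of "mon t * f'"] gf' unfolding t_def by auto
  have "mon t ^ l * (mon t * Poly_Mapping.single s c) \<in> ?I" using I.I_l_closed[OF top pow] by simp
  with l have "mon t ^ l * (mon t * f') + mon t ^ l * (mon t * Poly_Mapping.single s c) \<in> ?I"
    using additive_subgroup.a_closed[OF I.is_additive_subgroup] unfolding mpoly_ring_simps by blast
  also have "mon t ^ l * (mon t * f') + mon t ^ l * (mon t * Poly_Mapping.single s c) = mon t ^ Suc l * f"
    by (simp add: f'_def algebra_simps)
  finally show ?case unfolding t_def by blast
qed

section \<open>Prime ideals and variables\<close>

lemma primeideal_pow: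
  assumes P: "primeideal P R" and x: "x \<in> carrier R" "x [^]\<^bsub>R\<^esub> (k::nat) \<in> P"
  shows "x \<in> P"
proof -
  interpret P: primeideal P R by fact
  show ?thesis
    using x(2)
  proof (induction k)
    case 0
    then show ?case using P.one_imp_carrier P.I_notcarr by simp
  next
    case (Suc k)
    then show ?case using P.I_prime[of "x [^]\<^bsub>R\<^esub> k" x] x(1) by auto
  qed
qed

text \<open>Peel one variable off \<open>u\<close>: primeness puts it or the smaller cofactor into
  \<open>P\<close>, and the monomial 1 is excluded because \<open>P\<close> is proper.\<close>

lemma primeideal_mon_var:
  assumes P: "primeideal P (mpoly_ring n :: (monom \<Rightarrow>\<^sub>0 'k::field) ring)"
  shows "u \<in> monoms n \<Longrightarrow> mon u \<in> P \<Longrightarrow> \<exists>l\<in>Poly_Mapping.keys u. var l \<in> P"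
proof (induction "mdegree u" arbitrary: u rule: less_induct)
  case less
  interpret P: primeideal P "mpoly_ring n :: (monom \<Rightarrow>\<^sub>0 'k) ring" by fact
  have "(mon 0 :: monom \<Rightarrow>\<^sub>0 'k) \<notin> P" using P.one_imp_carrier P.I_notcarr by (auto simp: mon_def)
  then have "u \<noteq> 0" using less.prems(2) by auto
  then obtain l where l: "l \<in> Poly_Mapping.keys u" by (metis keys_eq_empty ex_in_conv)
  define v where "v = u - var_exp l"
  have u: "u = var_exp l + v"
    using l by (intro poly_mapping_eqI) (auto simp: v_def lookup_add lookup_minus lookup_single when_def in_keys_iff)
  have keys_v: "Poly_Mapping.keys v \<subseteq> Poly_Mapping.keys u" unfolding u by (auto simp: in_keys_iff lookup_add)
  then have v: "v \<in> monoms n" and lm: "var_exp l \<in> monoms n"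
    using less.prems(1) l by (auto simp: monoms_def)
  have "(var l * mon v :: monom \<Rightarrow>\<^sub>0 'k) \<in> P" using less.prems(2) u by (simp add: var_def mon_mult)
  then have "var l \<in> P \<or> mon v \<in> P"
    using P.I_prime[of "var l" "mon v"] v lm by (simp add: var_def)
  moreover have "mdegree v < mdegree u" unfolding u by (simp add: mdegree_add)
  ultimately show ?case using less.hyps[of v] v l keys_v by blast
qed

text \<open>Terms free of the variables in \<open>V\<close> survive modulo the ideal. If both
  factors have such terms, the product of the largest ones does not cancel and survives too.\<close>

lemma primeideal_vars:
  assumes V: "V \<subseteq> {1..n}"
  shows "primeideal (Idl\<^bsub>mpoly_ring n\<^esub> (var ` V)) (mpoly_ring n :: (monom \<Rightarrow>\<^sub>0 'k::field) ring)"
proof (rule primeidealI)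
  interpret R: cring "mpoly_ring n :: (monom \<Rightarrow>\<^sub>0 'k) ring" by (rule mpoly_ring_cring)
  let ?R = "mpoly_ring n :: (monom \<Rightarrow>\<^sub>0 'k) ring"
  let ?Q = "Idl\<^bsub>?R\<^esub> (var ` V)"
  note Q = genideal_vars[OF V, where 'k = 'k]
  show "ideal ?Q ?R" using V by (intro R.genideal_ideal) (auto simp: var_def single_in_monoms)
  show "cring ?R" by (rule mpoly_ring_cring)
  have "1 \<in> carrier ?R" "1 \<notin> ?Q" unfolding Q by (auto simp: monoms_def)
  then show "carrier ?R \<noteq> ?Q" by blast
  fix a b assume a: "a \<in> carrier ?R" and b: "b \<in> carrier ?R" and ab: "a \<otimes>\<^bsub>?R\<^esub> b \<in> ?Q"
  show "a \<in> ?Q \<or> b \<in> ?Q"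
  proof (rule ccontr)
    assume neg: "\<not> (a \<in> ?Q \<or> b \<in> ?Q)"
    define N where "N p = {u \<in> Poly_Mapping.keys p. \<forall>l\<in>V. expo u l = 0}" for p :: "monom \<Rightarrow>\<^sub>0 'k"
    have fin: "finite (N p)" for p unfolding N_def by simp
    have ne: "N a \<noteq> {}" "N b \<noteq> {}" using neg a b unfolding Q N_def by auto
    define s where "s = Max (N a)"
    define t where "t = Max (N b)"
    have s: "s \<in> N a" and t: "t \<in> N b" unfolding s_def t_def using fin ne by (auto intro: Max_in)
    have "Poly_Mapping.lookup (a * b) (s + t) = Poly_Mapping.lookup a s * Poly_Mapping.lookup b t"
    proof (rule lookup_mult_unique)
      fix v w assume v: "v \<in> Poly_Mapping.keys a" and w: "w \<in> Poly_Mapping.keys b" and eq: "v + w = s + t"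
      have "expo v l + expo w l = 0" if "l \<in> V" for l
        using that s t arg_cong[OF eq, of "\<lambda>u. expo u l"] by (simp add: lookup_add N_def)
      then have "v \<in> N a" "w \<in> N b" using v w by (auto simp: N_def)
      then have "v \<le> s" "w \<le> t" unfolding s_def t_def using fin by auto
      with eq show "v = s \<and> w = t" by (rule monom_add_le_unique)
    qed (use s t in \<open>auto simp: N_def\<close>)
    then have "s + t \<in> Poly_Mapping.keys (a * b)" using s t by (auto simp: N_def in_keys_iff)
    then obtain l where "l \<in> V" "expo (s + t) l \<noteq> 0" using ab unfolding Q by auto
    then show False using s t by (simp add: lookup_add N_def)
  qed
qed

text \<open>A power of the leading monomial of \<open>g\<close> in \<open>P\<close> annihilates
  \<open>f\<close> modulo \<open>I\<close>, so by primeness that monomial is in \<open>P\<close>.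
  Subtracting its term and repeating shows that every monomial of \<open>g\<close> involves a
  variable of \<open>P\<close>.\<close>

lemma associated_prime_monomial:
  fixes I P :: "(monom \<Rightarrow>\<^sub>0 'k::field) set"
  assumes I: "monomial_ideal n I" and P: "P \<in> associated_primes (mpoly_ring n) I"
  shows "P = Idl\<^bsub>mpoly_ring n\<^esub> (var ` {l \<in> {1..n}. var l \<in> P})"
proof -
  interpret R: cring "mpoly_ring n :: (monom \<Rightarrow>\<^sub>0 'k) ring" by (rule mpoly_ring_cring)
  let ?R = "mpoly_ring n :: (monom \<Rightarrow>\<^sub>0 'k) ring"
  obtain M where M: "monomial_filter n M" "I = {p. Poly_Mapping.keys p \<subseteq> M}"
    using monomial_ideal_filter[OF I] .
  have idI: "ideal I ?R" unfolding M(2) by (rule ideal_keys_in_filter[OF M(1)])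
  obtain f where prime: "primeideal P ?R" and f: "f \<in> carrier ?R"
    and Pf: "P = {a \<in> carrier ?R. a \<otimes>\<^bsub>?R\<^esub> f \<in> I}"
    using P unfolding R.associated_primes_iff[OF idI] by blast
  interpret P: primeideal P ?R by (rule prime)
  have keys_vars: "\<exists>l\<in>Poly_Mapping.keys u. var l \<in> P" if "g \<in> P" "u \<in> Poly_Mapping.keys g" for g u
    using that
  proof (induction "card (Poly_Mapping.keys g)" arbitrary: g)
    case 0
    then show ?case by simp
  next
    case (Suc m)
    define t where "t = Max (Poly_Mapping.keys g)"
    define c where "c = Poly_Mapping.lookup g t"
    define h where "h = g - Poly_Mapping.single t c"
    have t: "t \<in> Poly_Mapping.keys g" unfolding t_def using Suc.hyps(2) by (intro Max_in) auto
    have gn: "Poly_Mapping.keys g \<subseteq> monoms n" and gf: "Poly_Mapping.keys (g * f) \<subseteq> M"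
      using Suc.prems(1) unfolding Pf M(2) by auto
    then have tn: "mon t \<in> carrier ?R" using t by auto
    have "g \<noteq> 0" using t by auto
    then obtain l where "Poly_Mapping.keys (mon t ^ l * f) \<subseteq> M"
      using leading_monomial_annihilates[OF M(1) gn _ _ gf] f unfolding t_def by auto
    moreover have "mon t ^ l \<in> carrier ?R"
      using R.nat_pow_closed[OF tn, of l] by (simp only: pow_mpoly_ring)
    ultimately have "mon t ^ l \<in> P" unfolding Pf M(2) by simp
    then have mt: "mon t \<in> P" using primeideal_pow[OF prime tn, of l] by (simp add: pow_mpoly_ring)
    show ?case
    proof (cases "u = t")
      case True
      then show ?thesis using primeideal_mon_var[OF prime _ mt] t gn by auto
    next
      case False
      have "Poly_Mapping.single 0 (- c) \<otimes>\<^bsub>?R\<^esub> mon t \<in> P"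
        by (rule P.I_l_closed[OF mt]) (simp add: monoms_def)
      then have "g \<oplus>\<^bsub>?R\<^esub> Poly_Mapping.single 0 (- c) \<otimes>\<^bsub>?R\<^esub> mon t \<in> P"
        using Suc.prems(1) by (intro P.a_closed)
      then have "h \<in> P" by (simp add: h_def mon_def Poly_Mapping.mult_single single_uminus)
      moreover have kh: "Poly_Mapping.keys h = Poly_Mapping.keys g - {t}"
        unfolding h_def c_def by (rule keys_minus_single)
      then have "card (Poly_Mapping.keys h) = m" using t Suc.hyps(2) by simp
      ultimately show ?thesis using Suc.hyps(1)[of h] Suc.prems(2) kh False by simp
    qed
  qed
  show ?thesis
  proof
    have "\<exists>l\<in>{l \<in> {1..n}. var l \<in> P}. expo u l \<noteq> 0" if g: "g \<in> P" and u: "u \<in> Poly_Mapping.keys g" for g u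
    proof -
      have "u \<in> monoms n" using g u unfolding Pf by auto
      then have "Poly_Mapping.keys u \<subseteq> {1..n}" by (simp add: monoms_def)
      moreover obtain l where "l \<in> Poly_Mapping.keys u" "var l \<in> P" using keys_vars[OF g u] by blast
      ultimately have "l \<in> {l \<in> {1..n}. var l \<in> P}" "expo u l \<noteq> 0" by (blast, simp add: in_keys_iff)
      then show ?thesis by blast
    qed
    moreover have "u \<in> monoms n" if "g \<in> P" "u \<in> Poly_Mapping.keys g" for g u
      using that unfolding Pf by auto
    ultimately show "P \<subseteq> Idl\<^bsub>?R\<^esub> (var ` {l \<in> {1..n}. var l \<in> P})"
      by (subst genideal_vars) auto
    show "Idl\<^bsub>?R\<^esub> (var ` {l \<in> {1..n}. var l \<in> P}) \<subseteq> P"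
      by (rule R.genideal_minimal[OF P.ideal_axioms]) auto
  qed
qed

text \<open>If \<open>x_j\<close> annihilates \<open>f\<close> modulo \<open>I\<close>, Borel type
  gives the same for a power of each earlier variable, and primeness removes the power. So
  \<open>V\<close> is closed downwards.\<close>

lemma borel_type_associated_primes:
  fixes I P :: "(monom \<Rightarrow>\<^sub>0 'k::field) set"
  assumes I: "monomial_ideal n I" "I \<noteq> {0}" and B: "borel_type n I"
    and P: "P \<in> associated_primes (mpoly_ring n) I"
  shows "\<exists>r. 1 \<le> r \<and> r \<le> n \<and> P = Idl\<^bsub>mpoly_ring n\<^esub> (var ` {1..r})"
proof -
  interpret R: cring "mpoly_ring n :: (monom \<Rightarrow>\<^sub>0 'k) ring" by (rule mpoly_ring_cring)
  let ?R = "mpoly_ring n :: (monom \<Rightarrow>\<^sub>0 'k) ring"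
  obtain M where M: "monomial_filter n M" "I = {p. Poly_Mapping.keys p \<subseteq> M}"
    using monomial_ideal_filter[OF I(1)] .
  have idI: "ideal I ?R" unfolding M(2) by (rule ideal_keys_in_filter[OF M(1)])
  interpret I: ideal I ?R by (rule idI)
  obtain f where prime: "primeideal P ?R" and f: "f \<in> carrier ?R"
    and Pf: "P = {a \<in> carrier ?R. a \<otimes>\<^bsub>?R\<^esub> f \<in> I}"
    using P unfolding R.associated_primes_iff[OF idI] by blast
  define V where "V = {l \<in> {1..n}. (var l :: monom \<Rightarrow>\<^sub>0 'k) \<in> P}"
  have PV: "P = Idl\<^bsub>?R\<^esub> (var ` V)" unfolding V_def by (rule associated_prime_monomial[OF I(1) P])
  have vc: "(var l :: monom \<Rightarrow>\<^sub>0 'k) \<in> carrier ?R" if "l \<in> {1..n}" for l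
    using that by (simp add: var_def single_in_monoms)
  have down: "i \<in> V" if j: "j \<in> V" and i: "1 \<le> i" "i \<le> j" for i j
  proof -
    have jn: "j \<in> {1..n}" and jP: "(var j :: monom \<Rightarrow>\<^sub>0 'k) \<in> P" using j by (auto simp: V_def)
    have "f \<otimes>\<^bsub>?R\<^esub> var j [^]\<^bsub>?R\<^esub> (1::nat) \<in> I"
      using jP unfolding Pf pow_mpoly_ring by (simp add: mult.commute)
    moreover have "{1..j} \<subseteq> {1..n}" using jn by auto
    then have "var ` {1..j} \<subseteq> carrier ?R" using vc by blast
    ultimately have "f \<in> ideal_saturation ?R I (Idl\<^bsub>?R\<^esub> {var j})"
      using f vc[OF jn] by (subst R.ideal_saturation_genideal_iff[OF idI]) blast+
    then have "f \<in> ideal_saturation ?R I (Idl\<^bsub>?R\<^esub> (var ` {1..j}))"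
      using B jn by (simp add: borel_type_def)
    then have "\<exists>k::nat. f \<otimes>\<^bsub>?R\<^esub> var i [^]\<^bsub>?R\<^esub> k \<in> I"
      using jn vc i by (subst (asm) R.ideal_saturation_genideal_iff[OF idI]) (auto simp: image_subset_iff)
    then obtain k where "f \<otimes>\<^bsub>?R\<^esub> var i [^]\<^bsub>?R\<^esub> (k::nat) \<in> I" by blast
    moreover have ic: "(var i :: monom \<Rightarrow>\<^sub>0 'k) \<in> carrier ?R" using i jn vc by auto
    ultimately have "var i [^]\<^bsub>?R\<^esub> k \<in> P"
      using R.m_comm[OF f R.nat_pow_closed[OF ic, of k]] R.nat_pow_closed[OF ic, of k] unfolding Pf by (simp add: mult.commute)
    then show "i \<in> V" using primeideal_pow[OF prime ic] i jn by (auto simp: V_def)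
  qed
  \<comment> \<open>This gives \<open>1 \<le> r\<close>: an empty \<open>V\<close> would make
    \<open>P\<close> zero, although \<open>P\<close> contains the nonzero ideal
    \<open>I\<close>.\<close>
  have "V \<noteq> {}"
  proof
    assume "V = {}"
    then have "P \<subseteq> {0}" unfolding PV using genideal_vars[of "{}" n, where 'k = 'k] by auto
    moreover have "I \<subseteq> P" using I.I_r_closed[OF _ f] I.Icarr unfolding Pf by blast
    moreover have "0 \<in> I" by (simp add: M(2))
    ultimately show False using I(2) by blast
  qed
  have "finite V" by (simp add: V_def)
  define r where "r = Max V"
  have r: "r \<in> V" unfolding r_def using \<open>finite V\<close> \<open>V \<noteq> {}\<close> by (rule Max_in)
  have "V = {1..r}"
  proof
    show "V \<subseteq> {1..r}" using \<open>finite V\<close> by (auto simp: r_def V_def)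
    show "{1..r} \<subseteq> V" using down[OF r] by auto
  qed
  moreover have "1 \<le> r" "r \<le> n" using r by (auto simp: V_def)
  ultimately show ?thesis using PV by metis
qed

text \<open>Degrees in the box are at most \<open>n * D\<close>, so one can take a candidate of
  largest degree; raising an exponent within the box would increase it.\<close>

lemma maximal_bounded_monomial:
  assumes "\<exists>w\<in>monoms n. (\<forall>l. expo w l \<le> D) \<and> Q w"
  shows "\<exists>w\<in>monoms n. (\<forall>l. expo w l \<le> D) \<and> Q w \<and>
    (\<forall>l\<in>{1..n}. expo w l < D \<longrightarrow> \<not> Q (w + var_exp l))"
proof -
  let ?W = "\<lambda>w. w \<in> monoms n \<and> (\<forall>l. expo w l \<le> D) \<and> Q w"
  have "mdegree w < Suc (n * D)" if "?W w" for w
    using that sum_bounded_above[of "{1..n}" "expo w" D] mdegree_eq_sum[of w n] by auto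
  then obtain w where w: "?W w" "\<And>v. ?W v \<Longrightarrow> mdegree v \<le> mdegree w"
    using ex_has_greatest_nat[of ?W _ mdegree "Suc (n * D)"] assms by blast
  have "\<not> Q (w + var_exp l)" if l: "1 \<le> l" "l \<le> n" "expo w l < D" for l
  proof
    assume "Q (w + var_exp l)"
    moreover have "w + var_exp l \<in> monoms n"
      using w(1) l by (intro monoms_add single_in_monoms) auto
    moreover have "expo (w + var_exp l) l' \<le> D" for l'
      using w(1) l(3) by (auto simp: lookup_add lookup_single when_def)
    ultimately show False using w(2)[of "w + var_exp l"] by (simp add: mdegree_add)
  qed
  then show ?thesis using w(1) by (intro bexI[of _ w]) auto
qed

text \<open>
  With \<open>D\<close> bounding the generator exponents, an exponent \<open>\<ge> D\<close> cannot be improved by multiplication.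
  So for a maximal exponent vector \<open>w\<close> outside \<open>I\<close> with entries \<open>\<le> D\<close>, the annihilator of
  \<open>x\<^sup>w\<close> modulo \<open>I\<close> is generated by the variables whose exponent in \<open>w\<close> is less than \<open>D\<close>.
\<close>

lemma associated_primes_imp_exchange:
  fixes I :: "(monom \<Rightarrow>\<^sub>0 'k::field) set"
  assumes I: "monomial_ideal n I" and M: "monomial_filter n M" "I = {p. Poly_Mapping.keys p \<subseteq> M}"
    and ass: "\<forall>p\<in>associated_primes (mpoly_ring n) I.
      \<exists>r. 1 \<le> r \<and> r \<le> n \<and> p = Idl\<^bsub>mpoly_ring n\<^esub> (var ` {1..r})"
  shows "exchange n M"
  unfolding exchange_def
proof (intro ballI, rule ccontr)
  interpret R: cring "mpoly_ring n :: (monom \<Rightarrow>\<^sub>0 'k) ring" by (rule mpoly_ring_cring)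
  let ?R = "mpoly_ring n :: (monom \<Rightarrow>\<^sub>0 'k) ring"
  have idI: "ideal I ?R" unfolding M(2) by (rule ideal_keys_in_filter[OF M(1)])
  fix u j i assume u: "u \<in> M" and j: "j \<in> {1..n}" and i: "i \<in> {1..<j}"
    and no: "\<not> (\<exists>w\<in>M. expo w j = 0 \<and> (\<forall>l. l \<noteq> i \<longrightarrow> expo w l \<le> expo u l))"
  have un: "u \<in> monoms n" using u M(1) by (auto simp: monomial_filter_def)
  define D where "D = ideal_deg n I"
  have gens: "\<exists>g\<in>M. \<forall>l. expo g l \<le> expo v l \<and> expo g l \<le> D" if "v \<in> M" for v
    using monomial_filter_bounded_gens[OF I M that] order.trans[OF expo_le_mdegree] unfolding D_def by blast
  \<comment> \<open>The second condition will keep \<open>i\<close> out of \<open>V\<close>. The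
    third will force \<open>j\<close> into \<open>V\<close>, since otherwise a generator dividing
    \<open>u\<close> would divide \<open>w\<close>. The start \<open>w0\<close> is \<open>u\<close>
    with \<open>x_j\<close> deleted, \<open>x_i\<close> set to \<open>D\<close> and the rest capped
    at \<open>D\<close>.\<close>
  let ?Q = "\<lambda>w. w \<notin> M \<and> D \<le> expo w i \<and> (\<forall>l. l \<noteq> j \<longrightarrow> min D (expo u l) \<le> expo w l)"
  obtain w0 where w0: "w0 \<in> monoms n"
    "\<And>l. expo w0 l = (if l \<in> {1..n} then if l = i then D else if l = j then 0 else min D (expo u l) else 0)"
    using monom_with_exponents[of n "\<lambda>l. if l = i then D else if l = j then 0 else min D (expo u l)"] by auto
  have "w0 \<notin> M"
  proof
    assume "w0 \<in> M"
    moreover have "expo w0 j = 0" "\<forall>l. l \<noteq> i \<longrightarrow> expo w0 l \<le> expo u l" using i by (auto simp: w0(2))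
    ultimately show False using no by blast
  qed
  moreover have "D \<le> expo w0 i" using i j by (simp add: w0(2))
  moreover have "min D (expo u l) \<le> expo w0 l" if "l \<noteq> j" for l
  proof (cases "l \<in> {1..n}")
    case False
    then have "expo u l = 0" using un unfolding monoms_iff by fastforce
    then show ?thesis by simp
  qed (use that in \<open>simp add: w0(2)\<close>)
  moreover have "expo w0 l \<le> D" for l by (simp add: w0(2))
  ultimately have "\<exists>w\<in>monoms n. (\<forall>l. expo w l \<le> D) \<and> ?Q w" using w0(1) by blast
  then obtain w where w: "w \<in> monoms n" "\<And>l. expo w l \<le> D" "?Q w"
    and wmax: "\<And>l. l \<in> {1..n} \<Longrightarrow> expo w l < D \<Longrightarrow> \<not> ?Q (w + var_exp l)"
    using maximal_bounded_monomial[of n D ?Q] by blast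
  define V where "V = {l \<in> {1..n}. expo w l < D}"
  have Vn: "V \<subseteq> {1..n}" by (auto simp: V_def)
  \<comment> \<open>The two lower bounds in \<open>?Q\<close> survive multiplication, so maximality
    can only fail \<open>?Q\<close> through membership in \<open>M\<close>.\<close>
  have step: "w + var_exp l \<in> M" if "l \<in> V" for l
  proof (rule ccontr)
    assume "w + var_exp l \<notin> M"
    then have "?Q (w + var_exp l)" using w(3) by (auto simp: lookup_add intro: trans_le_add1)
    then show False using wmax[of l] that by (simp add: V_def)
  qed
  have iV: "i \<notin> V" using w(3) by (simp add: V_def)
  have jV: "j \<in> V"
  proof (rule ccontr)
    assume "j \<notin> V"
    then have wj: "D \<le> expo w j" using j by (simp add: V_def)
    obtain g where g: "g \<in> M" "\<And>l. expo g l \<le> expo u l \<and> expo g l \<le> D" using gens[OF u] by blast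
    have "expo g l \<le> expo w l" for l
      using g(2)[of l] w(3) wj by (cases "l = j") (auto intro: order.trans[of _ "min D (expo u l)"])
    then have "w \<in> M" using monomial_filter_upward[OF M(1) g(1) w(1)] by blast
    then show False using w(3) by blast
  qed
  have memb: "v + w \<in> M \<longleftrightarrow> (\<exists>l\<in>V. expo v l \<noteq> 0)" if v: "v \<in> monoms n" for v
  proof
    assume vw: "v + w \<in> M"
    then obtain g where g: "g \<in> M" "\<And>l. expo g l \<le> expo (v + w) l \<and> expo g l \<le> D" using gens by blast
    have gn: "g \<in> monoms n" using g(1) M(1) by (auto simp: monomial_filter_def)
    show "\<exists>l\<in>V. expo v l \<noteq> 0"
    proof (rule ccontr)
      assume neg: "\<not> (\<exists>l\<in>V. expo v l \<noteq> 0)"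
      have "expo g l \<le> expo w l" for l
      proof (cases "l \<in> V")
        case True
        then show ?thesis using g(2)[of l] neg by (simp add: lookup_add)
      next
        case False
        show ?thesis
        proof (cases "l \<in> {1..n}")
          case True
          then have "D \<le> expo w l" using False by (simp add: V_def)
          then show ?thesis using g(2)[of l] by linarith
        next
          case False
          then have "expo g l = 0" using gn unfolding monoms_iff by fastforce
          then show ?thesis by simp
        qed
      qed
      then have "w \<in> M" using monomial_filter_upward[OF M(1) g(1) w(1)] by blast
      then show False using w(3) by blast
    qed
  next
    assume "\<exists>l\<in>V. expo v l \<noteq> 0"
    then obtain l where l: "l \<in> V" "expo v l \<noteq> 0" by blast
    show "v + w \<in> M"
      by (rule monomial_filter_upward[OF M(1) step[OF l(1)] monoms_add[OF v w(1)]])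
        (use l(2) in \<open>auto simp: lookup_add lookup_single when_def\<close>)
  qed
  let ?P = "Idl\<^bsub>?R\<^esub> (var ` V)"
  have "?P = {a \<in> carrier ?R. a \<otimes>\<^bsub>?R\<^esub> mon w \<in> I}"
    unfolding genideal_vars[OF Vn] M(2) mpoly_ring_simps mem_Collect_eq keys_times_mon image_subset_iff
    using memb by blast
  moreover have "mon w \<in> carrier ?R" using w(1) by simp
  ultimately have "?P \<in> associated_primes ?R I"
    unfolding R.associated_primes_iff[OF idI] using primeideal_vars[OF Vn, where 'k = 'k] by blast
  then obtain r where r: "1 \<le> r" "r \<le> n" "?P = Idl\<^bsub>?R\<^esub> (var ` {1..r})" using ass by blast
  have var_mem: "(var l :: monom \<Rightarrow>\<^sub>0 'k) \<in> Idl\<^bsub>?R\<^esub> (var ` V') \<longleftrightarrow> l \<in> V'"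
    if "V' \<subseteq> {1..n}" "l \<in> {1..n}" for V' l
    unfolding genideal_vars[OF that(1)] using that
    by (auto simp: var_def lookup_single when_def single_in_monoms split: if_splits)
  have "{1..r} \<subseteq> {1..n}" using r by auto
  then have "j \<in> {1..r}" using var_mem[OF Vn j] var_mem[of "{1..r}" j] j jV r(3) by simp
  then have "i \<in> {1..r}" using i by auto
  moreover have "i \<in> {1..n}" using i j by auto
  ultimately have "i \<in> V" using var_mem[OF Vn, of i] var_mem[of "{1..r}" i] \<open>{1..r} \<subseteq> {1..n}\<close> r(3) by simp
  then show False using iV by blast
qed

section \<open>Stability in large degrees\<close>

lemma expo_max_var:
  assumes "u \<noteq> 0"
  shows "expo u (max_var u) \<noteq> 0" and "\<And>l. expo u l \<noteq> 0 \<Longrightarrow> l \<le> max_var u"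
proof -
  have "Poly_Mapping.keys u \<noteq> {}" using assms by (metis poly_mapping_eqI in_keys_iff lookup_zero empty_iff)
  then have "max_var u \<in> Poly_Mapping.keys u" unfolding max_var_def using assms by (simp add: Max_in)
  then show "expo u (max_var u) \<noteq> 0" by (simp add: in_keys_iff)
  show "l \<le> max_var u" if "expo u l \<noteq> 0" for l
    using that assms by (simp add: max_var_def in_keys_iff)
qed

lemma expo_stable_shift:
  assumes "j < max_var u"
  shows "expo (var_exp j + u - var_exp (max_var u)) l =
    (if l = j then Suc (expo u l) else if l = max_var u then expo u l - 1 else expo u l)"
  using assms by (auto simp: lookup_minus lookup_add lookup_single when_def)

lemma mdegree_stable_shift:
  assumes "j < max_var u"
  shows "mdegree (var_exp j + u - var_exp (max_var u)) = mdegree u"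
proof -
  have "u \<noteq> 0" using assms by (auto simp: max_var_def)
  then have "var_exp j + u - var_exp (max_var u) + var_exp (max_var u) = var_exp j + u"
    using expo_max_var(1)[of u] by (intro poly_mapping_eqI) (auto simp: lookup_minus lookup_add lookup_single when_def)
  then have "mdegree (var_exp j + u - var_exp (max_var u)) + 1 = 1 + mdegree u"
    by (metis mdegree_add mdegree_single)
  then show ?thesis by simp
qed

lemma stable_shift_in_monoms:
  assumes "u \<in> monoms n" "1 \<le> j" "j < max_var u"
  shows "var_exp j + u - var_exp (max_var u) \<in> monoms n"
proof -
  have "u \<noteq> 0" using assms(3) by (auto simp: max_var_def)
  then have "expo u (max_var u) \<noteq> 0" by (rule expo_max_var(1))
  then have "max_var u \<le> n" using assms(1) unfolding monoms_iff by blast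
  then show ?thesis
    using assms unfolding monoms_iff expo_stable_shift[OF assms(3)] by (auto split: if_splits)
qed

text \<open>Multiples do not lower the degree, so the monomials of the truncation are those of
  \<open>I\<close> of degree at least \<open>e\<close>. The shift preserves degree, so only
  membership in \<open>M\<close> remains to be tested.\<close>

lemma stable_ideal_geq_iff:
  fixes I :: "(monom \<Rightarrow>\<^sub>0 'k::field) set"
  assumes M: "monomial_filter n M" "I = {p. Poly_Mapping.keys p \<subseteq> M}"
  shows "stable_ideal n (ideal_geq n I e) \<longleftrightarrow>
    (\<forall>u\<in>M. e \<le> int (mdegree u) \<longrightarrow>
      (\<forall>j. 1 \<le> j \<and> j < max_var u \<longrightarrow> var_exp j + u - var_exp (max_var u) \<in> M))"
proof -
  let ?A = "{u \<in> monoms n. mon u \<in> I \<and> e \<le> int (mdegree u)}"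
  have A: "?A \<subseteq> monoms n" by auto
  have Mn: "M \<subseteq> monoms n" using M(1) by (simp add: monomial_filter_def)
  have mem: "mon u \<in> ideal_geq n I e \<longleftrightarrow> u \<in> M \<and> e \<le> int (mdegree u)" if u: "u \<in> monoms n" for u
  proof -
    have "mon u \<in> ideal_geq n I e \<longleftrightarrow> (\<exists>a\<in>?A. \<exists>c. u = a + c)"
      unfolding ideal_geq_def by (rule mon_in_genideal_iff[OF A u])
    also have "\<dots> \<longleftrightarrow> u \<in> M \<and> e \<le> int (mdegree u)"
    proof
      assume "u \<in> M \<and> e \<le> int (mdegree u)"
      then have "u \<in> ?A" using u M(2) by simp
      then show "\<exists>a\<in>?A. \<exists>c. u = a + c" by (intro bexI[of _ u] exI[of _ 0]) simp_all
    next
      assume "\<exists>a\<in>?A. \<exists>c. u = a + c"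
      then obtain a c where a: "a \<in> M" "e \<le> int (mdegree a)" "u = a + c" using M(2) by auto
      have "u \<in> M" using a by (intro monomial_filter_upward[OF M(1) a(1) u]) (simp add: lookup_add)
      then show "u \<in> M \<and> e \<le> int (mdegree u)" using a by (simp add: mdegree_add)
    qed
    finally show ?thesis .
  qed
  have "monomial_ideal n (ideal_geq n I e)"
    unfolding monomial_ideal_def ideal_geq_def using A by blast
  then have "stable_ideal n (ideal_geq n I e) \<longleftrightarrow>
    (\<forall>u\<in>monoms n. mon u \<in> ideal_geq n I e \<longrightarrow>
       (\<forall>j. 1 \<le> j \<and> j < max_var u \<longrightarrow> mon (var_exp j + u - var_exp (max_var u)) \<in> ideal_geq n I e))"
    by (simp add: stable_ideal_def)
  also have "\<dots> \<longleftrightarrow> (\<forall>u\<in>M. e \<le> int (mdegree u) \<longrightarrow>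
      (\<forall>j. 1 \<le> j \<and> j < max_var u \<longrightarrow> var_exp j + u - var_exp (max_var u) \<in> M))"
  proof -
    have "mon (var_exp j + u - var_exp (max_var u)) \<in> ideal_geq n I e \<longleftrightarrow>
      var_exp j + u - var_exp (max_var u) \<in> M \<and> e \<le> int (mdegree u)"
      if "u \<in> monoms n" "1 \<le> j" "j < max_var u" for u j
      using mem[OF stable_shift_in_monoms[OF that]] mdegree_stable_shift[OF that(3)] by simp
    then show ?thesis using mem Mn by blast
  qed
  finally show ?thesis .
qed

text \<open>
  Multiplying by a power of \<open>x\<^sub>i\<close> raises the degree to at least \<open>e\<close>; trading the last variable for
  \<open>x\<^sub>i\<close> repeatedly then eliminates all \<open>x\<^sub>l\<close> with \<open>l \<ge> j\<close>.
\<close>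

lemma stable_imp_exchange:
  fixes I :: "(monom \<Rightarrow>\<^sub>0 'k::field) set"
  assumes M: "monomial_filter n M" "I = {p. Poly_Mapping.keys p \<subseteq> M}"
    and stable: "stable_ideal n (ideal_geq n I e)"
  shows "exchange n M"
  unfolding exchange_def
proof (intro ballI)
  fix u j i assume u: "u \<in> M" and j: "j \<in> {1..n}" and i: "i \<in> {1..<j}"
  note stable' = stable[unfolded stable_ideal_geq_iff[OF M], rule_format]
  have *: "\<exists>w\<in>M. expo w j = 0 \<and> (\<forall>l. l \<noteq> i \<longrightarrow> expo w l \<le> expo v l)"
    if "v \<in> M" "e \<le> int (mdegree v)" for v
    using that
  proof (induction "\<Sum>l\<in>{j..n}. expo v l" arbitrary: v rule: less_induct)
    case less
    show ?case
    proof (cases "expo v j = 0")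
      case True
      then show ?thesis using less.prems(1) by auto
    next
      case False
      have vn: "v \<in> monoms n" using less.prems(1) M(1) by (auto simp: monomial_filter_def)
      have "v \<noteq> 0" using False by auto
      note mv = expo_max_var[OF this]
      have jm: "j \<le> max_var v" using mv(2)[OF False] .
      then have im: "i < max_var v" using i by auto
      have mn: "max_var v \<le> n" using mv(1) vn unfolding monoms_iff by blast
      define v' where "v' = var_exp i + v - var_exp (max_var v)"
      note ex = expo_stable_shift[OF im, folded v'_def]
      have "v' \<in> M" unfolding v'_def using stable' less.prems im i by auto
      moreover have "e \<le> int (mdegree v')"
        unfolding v'_def mdegree_stable_shift[OF im] by (rule less.prems(2))
      \<comment> \<open>The last variable has index in \<open>{j..n}\<close> because
        \<open>x_j\<close> divides \<open>v\<close>, whereas \<open>i < j\<close> lies outside, so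
        the sum drops.\<close>
      moreover have "(\<Sum>l\<in>{j..n}. expo v' l) < (\<Sum>l\<in>{j..n}. expo v l)"
        using jm mn mv(1) i by (intro sum_strict_mono_ex1) (auto simp: ex intro!: bexI[of _ "max_var v"])
      ultimately obtain w where w: "w \<in> M" "expo w j = 0" "\<And>l. l \<noteq> i \<Longrightarrow> expo w l \<le> expo v' l"
        using less.hyps by blast
      have "expo w l \<le> expo v l" if "l \<noteq> i" for l
        using w(3)[OF that] that unfolding ex by (auto split: if_splits)
      then show ?thesis using w by blast
    qed
  qed
  \<comment> \<open>The extra factor changes only the exponent at \<open>i\<close>, which
    \<open>exchange\<close> leaves free; \<open>nat\<close> sends a negative \<open>e\<close> to
    0.\<close>
  define v where "v = u + Poly_Mapping.single i (nat e)"
  have "Poly_Mapping.single i (nat e) \<in> monoms n" using i j by (intro single_in_monoms) auto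
  then have "v \<in> M" unfolding v_def using u M(1) by (simp add: monomial_filter_def)
  moreover have "e \<le> int (mdegree v)" by (simp add: v_def mdegree_add)
  ultimately obtain w where "w \<in> M" "expo w j = 0" "\<And>l. l \<noteq> i \<Longrightarrow> expo w l \<le> expo v l" using * by blast
  then show "\<exists>w\<in>M. expo w j = 0 \<and> (\<forall>l. l \<noteq> i \<longrightarrow> expo w l \<le> expo u l)"
    by (intro bexI[of _ w]) (auto simp: v_def lookup_add lookup_single when_def)
qed

text \<open>
  Let \<open>v = x\<^sub>j u / x\<^sub>s\<close> with \<open>s = m(u)\<close>. If some exponent of \<open>v\<close> before \<open>s\<close> is at least
  \<open>deg(I)\<close>, the exchange property yields a generator dividing \<open>v\<close>. Otherwise the degree of \<open>u\<close>
  forces its \<open>x\<^sub>s\<close>-exponent above that of any generator, so a generator dividing \<open>u\<close> divides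
  \<open>u / x\<^sub>s\<close>.
\<close>

lemma exchange_imp_stable:
  fixes I :: "(monom \<Rightarrow>\<^sub>0 'k::field) set"
  assumes I: "monomial_ideal n I" and M: "monomial_filter n M" "I = {p. Poly_Mapping.keys p \<subseteq> M}"
    and E: "exchange n M"
  shows "stable_ideal n (ideal_geq n I (q_bound n I))"
  unfolding stable_ideal_geq_iff[OF M]
proof (intro ballI impI allI)
  fix u j assume u: "u \<in> M" and q: "q_bound n I \<le> int (mdegree u)" and j: "1 \<le> j \<and> j < max_var u"
  define d where "d = ideal_deg n I"
  define m where "m = ideal_max_var n I"
  define s where "s = max_var u"
  define v where "v = var_exp j + u - var_exp (max_var u)"
  have js: "j < max_var u" using j by simp
  note ev = expo_stable_shift[OF js, folded v_def, folded s_def]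
  have un: "u \<in> monoms n" using u M(1) by (auto simp: monomial_filter_def)
  have vn: "v \<in> monoms n" unfolding v_def using j un by (intro stable_shift_in_monoms) auto
  have u0: "u \<noteq> 0" using j by (auto simp: max_var_def)
  note mu = expo_max_var[OF u0, folded s_def]
  have sn: "s \<in> {1..n}" using mu(1) un unfolding monoms_iff by auto
  obtain g where g: "g \<in> M" "\<And>l. expo g l \<le> expo u l" "mdegree g \<le> d" "max_var g \<le> m"
    using monomial_filter_bounded_gens[OF I M u] unfolding d_def m_def by blast
  \<comment> \<open>Passing from \<open>u\<close> to \<open>v\<close> lowers only the exponent at
    \<open>s\<close>, and by one, so strict inequality there lets \<open>g\<close> divide
    \<open>v\<close>.\<close>
  have done_if: "v \<in> M" if "expo g s < expo u s"
  proof (rule monomial_filter_upward[OF M(1) g(1) vn])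
    show "expo g l \<le> expo v l" for l
      using g(2)[of l] that unfolding ev by auto
  qed
  show "var_exp j + u - var_exp (max_var u) \<in> M"
    unfolding v_def[symmetric]
  proof (cases "\<exists>i\<in>{1..<s}. d \<le> expo v i")
    case True
    then obtain i where i: "i \<in> {1..<s}" "d \<le> expo v i" by blast
    \<comment> \<open>Exchange \<open>s\<close> for \<open>i\<close>. A generator \<open>h\<close>
      dividing \<open>w\<close> avoids \<open>x_s\<close>, has exponent at most \<open>d\<close> at
      \<open>i\<close>, and elsewhere stays below \<open>u\<close>, hence below
      \<open>v\<close>.\<close>
    obtain w where w: "w \<in> M" "expo w s = 0" "\<And>l. l \<noteq> i \<Longrightarrow> expo w l \<le> expo u l"
      using E u sn i(1) unfolding exchange_def by blast
    obtain h where h: "h \<in> M" "\<And>l. expo h l \<le> expo w l" "mdegree h \<le> d"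
      using monomial_filter_bounded_gens[OF I M w(1)] unfolding d_def by blast
    show "v \<in> M"
    proof (rule monomial_filter_upward[OF M(1) h(1) vn])
      fix l
      consider "l = i" | "l = s" | "l \<noteq> i" "l \<noteq> s" by blast
      then show "expo h l \<le> expo v l"
      proof cases
        case 1
        then show ?thesis using i(2) h(3) expo_le_mdegree[of h l] by simp
      next
        case 2
        then show ?thesis using h(2)[of l] w(2) by simp
      next
        case 3
        then show ?thesis using h(2)[of l] w(3)[of l] unfolding ev by auto
      qed
    qed
  next
    case False
    then have small: "\<And>i. i \<in> {1..<s} \<Longrightarrow> expo v i < d" by force
    show "v \<in> M"
    proof (cases "expo g s = 0")
      case True
      then show ?thesis using done_if mu(1) by simp
    next
      case False
      then have "g \<noteq> 0" by auto
      \<comment> \<open>Here \<open>m(I)\<close> enters: \<open>x_s\<close> divides a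
        generator.\<close>
      then have sm: "s \<le> m" using expo_max_var(2)[OF _ False] g(4) by simp
      \<comment> \<open>\<open>x_j\<close> divides \<open>v\<close>, so \<open>d\<close> is positive
        and the natural \<open>d - 1\<close> agrees with the integer difference in
        \<open>q_bound\<close>.\<close>
      have d: "d \<ge> 1" using small[of j] j by (simp add: s_def)
      have vs: "expo v l = 0" if "l > s" for l
        using that mu(2)[of l] js unfolding ev by (auto simp: s_def)
      have "mdegree v = (\<Sum>l\<in>{1..n}. expo v l)" using vn by (rule mdegree_eq_sum)
      also have "\<dots> = (\<Sum>l\<in>{1..<Suc s}. expo v l)"
        using sn vs by (intro sum.mono_neutral_right) (auto simp: not_le)
      also have "\<dots> = (\<Sum>l\<in>{1..<s}. expo v l) + expo v s" using sn by simp
      also have "(\<Sum>l\<in>{1..<s}. expo v l) \<le> (s - 1) * (d - 1)"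
      proof -
        have "expo v i \<le> d - 1" if "i \<in> {1..<s}" for i using small[OF that] by simp
        then show ?thesis using sum_bounded_above[of "{1..<s}" "expo v" "d - 1"] by simp
      qed
      finally have "mdegree u \<le> (s - 1) * (d - 1) + expo v s"
        unfolding v_def mdegree_stable_shift[OF js] by simp
      \<comment> \<open>Pigeonhole: the degree is at least
        \<open>s * (d - 1) + 1 = (s - 1) * (d - 1) + d\<close>, and the variables before
        \<open>x_s\<close> use at most \<open>(s - 1) * (d - 1)\<close>, leaving at least
        \<open>d\<close> for \<open>x_s\<close> in \<open>v\<close>.\<close>
      moreover have "int (m * (d - 1) + 1) \<le> int (mdegree u)"
        using q d unfolding q_bound_def d_def[symmetric] m_def[symmetric] by (simp add: of_nat_diff)
      then have "m * (d - 1) + 1 \<le> mdegree u" by (simp only: of_nat_le_iff)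
      moreover have "s * (d - 1) \<le> m * (d - 1)" using sm by (rule mult_le_mono1)
      moreover have "s * (d - 1) = (s - 1) * (d - 1) + (d - 1)" using sn by (cases s) auto
      ultimately have "d \<le> expo v s" using d by linarith
      moreover have "expo v s = expo u s - 1" using j unfolding ev by (simp add: s_def)
      ultimately have "expo g s < expo u s" using expo_le_mdegree[of g s] g(3) mu(1) by linarith
      then show ?thesis by (rule done_if)
    qed
  qed
qed

theorem theorem2p2:
  fixes n :: nat and I :: "(monom \<Rightarrow>\<^sub>0 'k::field) set"
  assumes "n \<ge> 2"
    and "monomial_ideal n I"
    and "I \<noteq> {0}"
  shows "(borel_type n I \<longleftrightarrow>
           (\<forall>p\<in>associated_primes (mpoly_ring n) I.
              \<exists>r. 1 \<le> r \<and> r \<le> n \<and> p = Idl\<^bsub>mpoly_ring n\<^esub> (var ` {1..r})))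
       \<and> ((\<forall>p\<in>associated_primes (mpoly_ring n) I.
              \<exists>r. 1 \<le> r \<and> r \<le> n \<and> p = Idl\<^bsub>mpoly_ring n\<^esub> (var ` {1..r})) \<longleftrightarrow>
           stable_ideal n (ideal_geq n I (q_bound n I)))"
proof -
  obtain M where M: "monomial_filter n M" "I = {p. Poly_Mapping.keys p \<subseteq> M}"
    using monomial_ideal_filter[OF assms(2)] .
  have "borel_type n I \<longleftrightarrow> exchange n M"
    unfolding M(2) by (rule borel_type_iff_exchange[OF M(1)])
  moreover have "stable_ideal n (ideal_geq n I (q_bound n I)) \<longleftrightarrow> exchange n M"
    using exchange_imp_stable[OF assms(2) M] stable_imp_exchange[OF M] by blast
  ultimately show ?thesis
    using borel_type_associated_primes[OF assms(2,3)] associated_primes_imp_exchange[OF assms(2) M] by blast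
qed

end
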